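(* The $*$-algebra $L(Z_2)/S(Z_2)$, equipped with the quotient norm, is not $*$-isomorphic to a $B^*$-algebra.
   Context: The scalar field is either $\mathbb{R}$ or $\mathbb{C}$. The Kalton--Peck space $Z_2$ is the twisted sum $\ell_2\oplus_{\Omega}\ell_2$, where $\Omega=\Omega_2$ is the quasi-linear map given on finitely supported vectors by $\Omega(x)(n)=x(n)\log\frac{\|x\|_2}{|x(n)|}$ (with value $0$ where $x(n)=0$); i.e. $Z_2$ is the space of pairs $(x,y)$ of sequences with $y\in\ell_2$, $x-\Omega y\in\ell_2$, with quasi-norm $\|(x,y)\|=\|x-\Omega y\|_2+\|y\|_2$, which is equivalent to a Banach space norm. $L(Z_2)$ is the algebra of bounded linear operators on $Z_2$ and $S(Z_2)$ the closed ideal of strictly singular operators (operators whose restriction to any infinite dimensional closed subspace is not an isomorphism onto its range). The quotient norm is $\|T+S(Z_2)\|=\inf\{\|T-S\|:S\in S(Z_2)\}$. The form $\omega((x,y),(x',y'))=\langle x,y'\rangle-\langle y,x'\rangle$ (with the $\ell_2$ inner product, on finitely supported vectors, extended by continuity) is a symplectic form on $Z_2$, and the involution $*$ on $L(Z_2)$ is defined by $\omega(Tu,v)=\omega(u,T^*v)$; since $T$ is strictly singular iff $T^*$ is, it induces an involution on $L(Z_2)/S(Z_2)$. A $B^*$-algebra is a Banach $*$-algebra whose norm satisfies $\|a^*a\|=\|a\|^2$ for all $a$. A $*$-isomorphism of Banach $*$-algebras is a bijective algebra homomorphism preserving the involution which is a linear homeomorphism. *)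

theory Defs
  imports "HOL-Analysis.Analysis" "HOL-Library.Function_Algebras"
begin

(* A commutative normed field over the reals is R or C (Gelfand-Mazur), so the only models
   of this class are R and C; conj is then the identity or complex conjugation. *)
class real_or_complex = real_normed_field + banach +
  fixes conj :: "'a \<Rightarrow> 'a"
  assumes conj_add: "conj (x + y) = conj x + conj y"
    and conj_mult: "conj (x * y) = conj x * conj y"
    and mult_conj: "x * conj x = ((norm x)\<^sup>2) *\<^sub>R 1"

instantiation real :: real_or_complex
begin
definition conj_real :: "real \<Rightarrow> real" where "conj_real x = x"
instance
  by standard (auto simp: conj_real_def power2_eq_square)
end

instantiation complex :: real_or_complex
begin
definition conj_complex :: "complex \<Rightarrow> complex" where "conj_complex = cnj"
instance
proof
  fix x y :: complex
  show "conj (x + y) = conj x + conj y" "conj (x * y) = conj x * conj y"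
    by (simp_all add: conj_complex_def)
  show "x * conj x = ((norm x)\<^sup>2) *\<^sub>R 1"
    using complex_norm_square[of x] by (simp add: conj_complex_def scaleR_conv_of_real)
qed
end

section \<open>The Kalton--Peck space\<close>

definition ell2 :: "(nat \<Rightarrow> 'k::real_or_complex) set" where
  "ell2 = {x. summable (\<lambda>n. (norm (x n))\<^sup>2)}"

definition ell2_norm :: "(nat \<Rightarrow> 'k::real_or_complex) \<Rightarrow> real" where
  "ell2_norm x = sqrt (\<Sum>n. (norm (x n))\<^sup>2)"

definition KP_map :: "(nat \<Rightarrow> 'k::real_or_complex) \<Rightarrow> (nat \<Rightarrow> 'k)" where
  "KP_map x = (\<lambda>n. if x n = 0 then 0 else x n * of_real (ln (ell2_norm x / norm (x n))))"

type_synonym 'k seq_pair = "(nat \<Rightarrow> 'k) \<times> (nat \<Rightarrow> 'k)"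

definition seq_scale :: "'k::real_or_complex \<Rightarrow> 'k seq_pair \<Rightarrow> 'k seq_pair" where
  "seq_scale c u = ((\<lambda>n. c * fst u n), (\<lambda>n. c * snd u n))"

interpretation seq_pair: vector_space seq_scale
  by standard (auto simp: seq_scale_def fun_eq_iff algebra_simps)

definition Z2 :: "'k::real_or_complex seq_pair set" where
  "Z2 = {(x, y). y \<in> ell2 \<and> x - KP_map y \<in> ell2}"

definition Z2_qnorm :: "'k::real_or_complex seq_pair \<Rightarrow> real" where
  "Z2_qnorm u = ell2_norm (fst u - KP_map (snd u)) + ell2_norm (snd u)"

(* No triangle inequality is required, so that this covers Z2_qnorm itself as well as every
   Banach space norm equivalent to it. *)
definition Z2_equivalent_norm :: "('k::real_or_complex seq_pair \<Rightarrow> real) \<Rightarrow> bool" where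
  "Z2_equivalent_norm N \<longleftrightarrow>
     (\<forall>c. \<forall>u\<in>Z2. N (seq_scale c u) = norm c * N u) \<and>
     (\<exists>C>0. \<forall>u\<in>Z2. N u \<le> C * Z2_qnorm u \<and> Z2_qnorm u \<le> C * N u)"

lemma ell2_norm_mult:
  assumes "x \<in> ell2"
  shows "ell2_norm (\<lambda>n. c * x n) = norm c * ell2_norm x"
proof -
  have "(\<Sum>n. (norm (c * x n))\<^sup>2) = (norm c)\<^sup>2 * (\<Sum>n. (norm (x n))\<^sup>2)"
    using assms by (simp add: ell2_def norm_mult power_mult_distrib suminf_mult)
  then show ?thesis
    by (simp add: ell2_norm_def real_sqrt_mult)
qed

lemma KP_map_mult:
  assumes "y \<in> ell2"
  shows "KP_map (\<lambda>n. c * y n) = (\<lambda>n. c * KP_map y n)"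
proof
  fix n
  show "KP_map (\<lambda>n. c * y n) n = c * KP_map y n"
    by (cases "c = 0") (simp_all add: KP_map_def ell2_norm_mult[OF assms] norm_mult)
qed

lemma Z2_equivalent_norm_qnorm: "Z2_equivalent_norm Z2_qnorm"
proof -
  have "Z2_qnorm (seq_scale c u) = norm c * Z2_qnorm u" if u_in: "u \<in> Z2" for c and u :: "'a seq_pair"
  proof -
    obtain x y where u: "u = (x, y)" "y \<in> ell2" "x - KP_map y \<in> ell2"
      using u_in by (auto simp: Z2_def)
    have "(\<lambda>n. c * x n) - KP_map (\<lambda>n. c * y n) = (\<lambda>n. c * (x - KP_map y) n)"
      by (simp only: KP_map_mult[OF u(2)] fun_diff_def right_diff_distrib)
    then show ?thesis
      using ell2_norm_mult[OF u(2), of c] ell2_norm_mult[OF u(3), of c]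
      by (simp only: Z2_qnorm_def seq_scale_def u(1) fst_conv snd_conv distrib_left)
  qed
  moreover have "\<exists>C>0. \<forall>u\<in>Z2. Z2_qnorm u \<le> C * Z2_qnorm u \<and> Z2_qnorm u \<le> C * Z2_qnorm (u :: 'a seq_pair)"
    by (rule exI[of _ 1]) simp
  ultimately show ?thesis
    unfolding Z2_equivalent_norm_def by blast
qed

section \<open>Operators\<close>

(* Operators are normalised to vanish off Z2, so that equality, pointwise sums and
   compositions of functions are those of operators on Z2. *)
definition Z2_operators :: "('k::real_or_complex seq_pair \<Rightarrow> 'k seq_pair) set" where
  "Z2_operators = {T.
     (\<forall>u\<in>Z2. T u \<in> Z2) \<and> (\<forall>u. u \<notin> Z2 \<longrightarrow> T u = 0) \<and>
     (\<forall>u\<in>Z2. \<forall>v\<in>Z2. T (u + v) = T u + T v) \<and>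
     (\<forall>c. \<forall>u\<in>Z2. T (seq_scale c u) = seq_scale c (T u)) \<and>
     (\<exists>C. \<forall>u\<in>Z2. Z2_qnorm (T u) \<le> C * Z2_qnorm u)}"

definition closed_subspace_Z2 :: "'k::real_or_complex seq_pair set \<Rightarrow> bool" where
  "closed_subspace_Z2 M \<longleftrightarrow> M \<subseteq> Z2 \<and> seq_pair.subspace M \<and>
     (\<forall>u\<in>Z2. (\<forall>e>0. \<exists>m\<in>M. Z2_qnorm (u - m) < e) \<longrightarrow> u \<in> M)"

definition infinite_dimensional :: "'k::real_or_complex seq_pair set \<Rightarrow> bool" where
  "infinite_dimensional M \<longleftrightarrow> \<not> (\<exists>B. finite B \<and> M \<subseteq> seq_pair.span B)"

(* A bounded operator restricts to an isomorphism of M onto its range iff it is bounded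
   below on M. *)
definition Z2_strictly_singular :: "('k::real_or_complex seq_pair \<Rightarrow> 'k seq_pair) set" where
  "Z2_strictly_singular = {T \<in> Z2_operators.
     \<not> (\<exists>M. closed_subspace_Z2 M \<and> infinite_dimensional M \<and>
          (\<exists>c>0. \<forall>u\<in>M. c * Z2_qnorm u \<le> Z2_qnorm (T u)))}"

definition operator_norm ::
  "('k::real_or_complex seq_pair \<Rightarrow> real) \<Rightarrow> ('k seq_pair \<Rightarrow> 'k seq_pair) \<Rightarrow> real" where
  "operator_norm N T = (SUP u\<in>{u \<in> Z2. N u \<le> 1}. N (T u))"

(* The continuous extension of the form on finitely supported vectors: its value at (u, v)
   is the limit of its values at the coordinate truncations of u and v, which converge to u
   and v in Z2. The series converges absolutely on Z2, because with u = (x, y),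
   v = (x', y') and norm y = norm y' = 1 the contribution of KP_map to the n-th term is
   bounded by a * b * |ln (a / b)| <= max(a, b)^2, where a = |y n| and b = |y' n|. *)
definition Z2_form :: "'k::real_or_complex seq_pair \<Rightarrow> 'k seq_pair \<Rightarrow> 'k" where
  "Z2_form u v = (\<Sum>n. fst u n * conj (snd v n) - snd u n * conj (fst v n))"

definition Z2_adjoint ::
  "('k::real_or_complex seq_pair \<Rightarrow> 'k seq_pair) \<Rightarrow> ('k seq_pair \<Rightarrow> 'k seq_pair)" where
  "Z2_adjoint T = (THE R. R \<in> Z2_operators \<and>
     (\<forall>u\<in>Z2. \<forall>v\<in>Z2. Z2_form (T u) v = Z2_form u (R v)))"

section \<open>The quotient algebra and B*-algebras\<close>

definition SS_class ::
  "('k::real_or_complex seq_pair \<Rightarrow> 'k seq_pair) \<Rightarrow> ('k seq_pair \<Rightarrow> 'k seq_pair) set" where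
  "SS_class T = (\<lambda>S. T - S) ` Z2_strictly_singular"

definition Z2_quotient :: "('k::real_or_complex seq_pair \<Rightarrow> 'k seq_pair) set set" where
  "Z2_quotient = SS_class ` Z2_operators"

definition quotient_norm ::
  "('k::real_or_complex seq_pair \<Rightarrow> real) \<Rightarrow> ('k seq_pair \<Rightarrow> 'k seq_pair) set \<Rightarrow> real" where
  "quotient_norm N A = (INF T\<in>A. operator_norm N T)"

(* The sort provides a (possibly non-unital) real Banach algebra; the scalar action of the
   field 'k extends that of the reals. *)
locale b_star_algebra =
  vector_space smul
  for smul :: "'k::real_or_complex \<Rightarrow> 'b::{real_normed_algebra, banach} \<Rightarrow> 'b" +
  fixes star :: "'b \<Rightarrow> 'b"
  assumes scale_of_real: "smul (of_real r) a = r *\<^sub>R a"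
    and scale_mult_left: "smul c (a * b) = smul c a * b"
    and scale_mult_right: "smul c (a * b) = a * smul c b"
    and norm_scale: "norm (smul c a) = norm c * norm a"
    and star_add: "star (a + b) = star a + star b"
    and star_scale: "star (smul c a) = smul (conj c) (star a)"
    and star_mult: "star (a * b) = star b * star a"
    and star_star: "star (star a) = a"
    and b_star: "norm (star a * a) = (norm a)\<^sup>2"

(* The operations of the quotient *-algebra are those of representatives:
   [T] + [R] = [T + R], c [T] = [c T], [T] [R] = [T o R], [T]* = [T*].
   A linear bijection is a homeomorphism iff it and its inverse are bounded. *)
definition quotient_star_isomorphism ::
  "('k::real_or_complex seq_pair \<Rightarrow> real) \<Rightarrow>
   ('k \<Rightarrow> 'b::{real_normed_algebra, banach} \<Rightarrow> 'b) \<Rightarrow> ('b \<Rightarrow> 'b) \<Rightarrow>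
   (('k seq_pair \<Rightarrow> 'k seq_pair) set \<Rightarrow> 'b) \<Rightarrow> bool" where
  "quotient_star_isomorphism N smul star \<phi> \<longleftrightarrow>
     bij_betw \<phi> Z2_quotient UNIV \<and>
     (\<forall>T\<in>Z2_operators. \<forall>R\<in>Z2_operators.
        \<phi> (SS_class (T + R)) = \<phi> (SS_class T) + \<phi> (SS_class R)) \<and>
     (\<forall>c. \<forall>T\<in>Z2_operators.
        \<phi> (SS_class (\<lambda>u. seq_scale c (T u))) = smul c (\<phi> (SS_class T))) \<and>
     (\<forall>T\<in>Z2_operators. \<forall>R\<in>Z2_operators.
        \<phi> (SS_class (T \<circ> R)) = \<phi> (SS_class T) * \<phi> (SS_class R)) \<and>
     (\<forall>T\<in>Z2_operators. \<phi> (SS_class (Z2_adjoint T)) = star (\<phi> (SS_class T))) \<and>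
     (\<exists>C. \<forall>A\<in>Z2_quotient. norm (\<phi> A) \<le> C * quotient_norm N A) \<and>
     (\<exists>C. \<forall>A\<in>Z2_quotient. quotient_norm N A \<le> C * norm (\<phi> A))"

end

theory Submission
  imports Defs
begin

text \<open>
  In a B*-algebra a product of self-adjoint involutions has the norm of the unit, so it suffices to
  find symplectic involutions of \<open>Z2\<close> whose products stay far from all strictly singular operators.
  Hadamard matrices of order \<open>n = 2 ^ m\<close>, repeated along consecutive blocks of \<open>n\<close> coordinates, act
  on \<open>Z2\<close> and are such products. They exchange unit vectors, on which \<open>KP_map\<close> vanishes, with flat
  vectors, on which \<open>KP_map\<close> is multiplication by \<open>L = ln (sqrt n)\<close>. Evaluating the form of a
  bounded operator \<open>T\<close> on unit vectors and their flat images, in both orders, and subtracting, the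
  contribution of the entries of \<open>T\<close> from the second to the first component cancels because the
  matrix is symmetric. What remains bounds \<open>L\<close> times the normalised trace pairing of the two
  diagonal components of \<open>T\<close> with the Hadamard matrix by a multiple of the norm of \<open>T\<close>.

  A strictly singular operator does not contribute to this pairing in the limit of far blocks. For
  every bounded operator the entries from the first to the second component tend to zero along
  pairs of injective sequences, and so do the differences of the entries of the two diagonal
  components: otherwise averaging over signs of flat vectors would produce terms of order \<open>L ^ 2\<close> or
  \<open>L\<close>. If the entries of the first component did not tend to zero, a gliding hump argument would
  make the operator bounded below on a copy of the sequence space \<open>ell2\<close>.
  So the quotient norm of the Hadamard operators grows like \<open>L\<close>.
\<close>

section \<open>Conjugation and phases of scalars\<close>

lemma conj_0 [simp]: "conj (0 :: 'k::real_or_complex) = 0"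
  using conj_add[of "0::'k" 0] by simp

lemma conj_minus: "conj (- x :: 'k::real_or_complex) = - conj x"
proof -
  have "conj x + conj (- x) = 0"
    by (metis conj_0 conj_add add.right_inverse)
  then show ?thesis
    by (simp add: add_eq_0_iff)
qed

lemma conj_diff: "conj (x - y :: 'k::real_or_complex) = conj x - conj y"
  using conj_add[of x "- y"] by (simp add: conj_minus)

text \<open>The class does not postulate that \<open>conj\<close> fixes the reals; cancelling
  \<open>of_real r\<close> in \<open>mult_conj\<close> forces it.\<close>

lemma conj_of_real [simp]: "conj (of_real r :: 'k::real_or_complex) = of_real r"
proof (cases "r = 0")
  case False
  have "of_real r * conj (of_real r :: 'k) = of_real r * of_real r"
    unfolding mult_conj by (simp add: power2_eq_square of_real_def)
  with False show ?thesis
    by (metis mult_left_cancel of_real_eq_0_iff)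
qed simp

lemma conj_1 [simp]: "conj (1 :: 'k::real_or_complex) = 1"
  using conj_of_real[of 1] by simp

lemma norm_conj [simp]: "norm (conj x :: 'k::real_or_complex) = norm x"
proof (cases "x = 0")
  case False
  have "norm x * norm (conj x) = norm x * norm x"
    by (metis mult_conj norm_mult norm_scaleR norm_one abs_power2 mult.right_neutral power2_eq_square)
  with False show ?thesis by simp
qed simp

lemma exists_phase:
  fixes z :: "'k::real_or_complex"
  obtains w where "norm w = 1" "z * conj w = of_real (norm z)"
proof (cases "z = 0")
  case True
  then show ?thesis using that[of 1] by simp
next
  case False
  define w where "w = z * of_real (inverse (norm z))"
  have "z * conj w = (z * conj z) * of_real (inverse (norm z))"
    by (simp only: w_def conj_mult conj_of_real mult.assoc)
  also have "\<dots> = of_real ((norm z)\<^sup>2 * inverse (norm z))"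
    by (simp only: mult_conj of_real_def[symmetric] of_real_mult)
  also have "(norm z)\<^sup>2 * inverse (norm z) = norm z"
    using False by (simp add: power2_eq_square)
  finally have "z * conj w = of_real (norm z)" .
  moreover have "norm w = 1"
    using False by (simp add: w_def norm_mult norm_inverse)
  ultimately show ?thesis using that by blast
qed

section \<open>Scalar inequalities with logarithms, and a choice of signs\<close>

lemma mult_ln_divide_le:
  fixes t M :: real
  assumes "0 \<le> t" "t \<le> M"
  shows "\<bar>t * ln (M / t)\<bar> \<le> M"
proof (cases "t = 0")
  case False
  then have "0 \<le> ln (M / t)" "ln (M / t) \<le> M / t"
    using assms by (auto simp: ln_le_minus_one intro: order.trans[OF ln_le_minus_one])
  then show ?thesis
    using False assms mult_left_mono[of "ln (M / t)" "M / t" t] by simp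
qed (use assms in auto)

text \<open>From \<open>ln x \<le> x - 1\<close>, applied to the quotient in either order. It makes
  the logarithmic part of the symplectic form absolutely summable.\<close>

lemma mult_ln_quotient_le:
  fixes s t :: real
  assumes "0 < s" "0 < t"
  shows "s * t * \<bar>ln s - ln t\<bar> \<le> s\<^sup>2 + t\<^sup>2"
proof -
  have *: "a * b * (ln a - ln b) \<le> a\<^sup>2" if "0 < a" "0 < b" for a b :: real
  proof -
    have "ln a - ln b \<le> a / b"
      using that ln_le_minus_one[of "a / b"] by (simp add: ln_div)
    then have "a * b * (ln a - ln b) \<le> a * b * (a / b)"
      using that by (intro mult_left_mono) auto
    then show ?thesis using that by (simp add: power2_eq_square)
  qed
  show ?thesis
    using *[OF assms] *[OF assms(2,1)] assms
    by (simp add: abs_if power2_eq_square algebra_simps) (smt (verit) mult_pos_pos)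
qed

text \<open>Rescaling by \<open>s = norm a + norm b\<close> turns
  \<open>c * of_real (ln (norm c))\<close> into a term linear in \<open>c\<close>, which cancels,
  minus \<open>g c\<close>, whose norm is at most \<open>s\<close> when
  \<open>norm c \<le> s\<close>. Three such terms give the constant 3.\<close>

lemma xlnx_quasi_additive:
  fixes a b :: "'k::real_or_complex"
  shows "norm ((a + b) * of_real (ln (norm (a + b))) - a * of_real (ln (norm a))
               - b * of_real (ln (norm b))) \<le> 3 * (norm a + norm b)"
proof (cases "norm a + norm b = 0")
  case True
  then have "a = 0" "b = 0" by (smt (verit) norm_ge_zero norm_eq_zero)+
  then show ?thesis by simp
next
  case False
  define s where "s = norm a + norm b"
  have s: "0 < s" using False norm_ge_zero[of a] norm_ge_zero[of b] by (smt (verit) s_def)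
  define g where "g c = c * of_real (ln (s / norm c))" for c :: 'k
  have g: "norm (g c) \<le> s" if "norm c \<le> s" for c
    using mult_ln_divide_le[of "norm c" s] that by (simp add: g_def norm_mult abs_mult)
  have k: "c * of_real (ln (norm c)) = c * of_real (ln s) - g c" for c
    using s by (cases "c = 0") (simp_all add: g_def ln_div algebra_simps)
  have "(a + b) * of_real (ln (norm (a + b))) - a * of_real (ln (norm a)) - b * of_real (ln (norm b))
      = g a + g b - g (a + b)"
    by (simp only: k) (simp add: algebra_simps)
  moreover have "norm (g a + g b - g (a + b)) \<le> s + s + s"
    by (intro order.trans[OF norm_triangle_ineq4] order.trans[OF norm_triangle_ineq] add_mono g)
       (auto simp: s_def norm_triangle_ineq)
  ultimately show ?thesis by (simp add: s_def)
qed

text \<open>Averaged over all signs the off-diagonal terms cancel, so some choice of signs does not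
  fall below the diagonal. The induction fixes one sign at a time; \<open>c\<close> is arbitrary so
  that it can absorb the diagonal term of the new index.\<close>

lemma sign_choice:
  fixes B :: "'a \<Rightarrow> 'a \<Rightarrow> 'k::real_normed_field"
  assumes "finite A"
  shows "\<exists>s::'a \<Rightarrow> real. (\<forall>a. \<bar>s a\<bar> = 1) \<and>
    norm (c + (\<Sum>a\<in>A. B a a)) \<le> norm (c + (\<Sum>a\<in>A. \<Sum>b\<in>A. of_real (s a * s b) * B a b))"
  using assms
proof (induction A arbitrary: c rule: finite_induct)
  case empty
  show ?case by (rule exI[of _ "\<lambda>_. 1"]) simp
next
  case (insert x A)
  obtain s where s: "\<forall>a. \<bar>s a\<bar> = 1" and
    le: "norm ((c + B x x) + (\<Sum>a\<in>A. B a a)) \<le>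
      norm ((c + B x x) + (\<Sum>a\<in>A. \<Sum>b\<in>A. of_real (s a * s b) * B a b))"
    using insert.IH[of "c + B x x"] by blast
  define w where "w = (c + B x x) + (\<Sum>a\<in>A. \<Sum>b\<in>A. of_real (s a * s b) * B a b)"
  \<comment> \<open>\<open>X\<close> collects the cross terms between the new index and the old
    ones: it is the only part that depends on the new sign.\<close>
  define X where "X = (\<Sum>a\<in>A. of_real (s a) * B a x) + (\<Sum>b\<in>A. of_real (s b) * B x b)"
  have expand: "c + (\<Sum>a\<in>insert x A. \<Sum>b\<in>insert x A. of_real ((s(x:=e)) a * (s(x:=e)) b) * B a b)
     = w + of_real e * X" if "\<bar>e\<bar> = 1" for e
  proof -
    have ee: "e * e = 1" using that by (metis abs_mult_self_eq mult_1)
    have upd: "(s(x:=e)) a = s a" if "a \<in> A" for a using that insert.hyps by auto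
    have "(\<Sum>a\<in>insert x A. \<Sum>b\<in>insert x A. of_real ((s(x:=e)) a * (s(x:=e)) b) * B a b)
      = (of_real (e * e) * B x x + (\<Sum>b\<in>A. of_real (e * s b) * B x b)) +
        (\<Sum>a\<in>A. of_real (s a * e) * B a x + (\<Sum>b\<in>A. of_real (s a * s b) * B a b))"
      using insert.hyps by (simp add: upd cong: sum.cong del: fun_upd_apply) (simp add: fun_upd_def)
    then show ?thesis
      by (simp add: ee w_def X_def sum.distrib sum_distrib_left algebra_simps)
  qed
  \<comment> \<open>\<open>w + w\<close> is the sum of \<open>w + X\<close> and
    \<open>w - X\<close>, so one of these is at least as long as \<open>w\<close>.\<close>
  have "norm w \<le> norm (w + X) \<or> norm w \<le> norm (w - X)"
  proof (rule ccontr)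
    assume "\<not> ?thesis"
    moreover have "norm (w + w) \<le> norm (w + X) + norm (w - X)"
      using norm_triangle_ineq[of "w + X" "w - X"] by (simp add: algebra_simps)
    moreover have "norm (w + w) = 2 * norm w" by (metis mult_2 norm_mult norm_numeral)
    ultimately show False by linarith
  qed
  then obtain e where e: "\<bar>e\<bar> = (1::real)" "norm w \<le> norm (w + of_real e * X)"
    by (elim disjE) (rule that[of 1], simp_all, rule that[of "-1"], simp_all)
  show ?case
    by (rule exI[of _ "s(x:=e)"])
       (use e s le insert.hyps in \<open>simp only: expand[OF e(1)], simp add: w_def algebra_simps\<close>)
qed

subsection \<open>Square summable sequences\<close>

lemma ell2_bound_partial:
  assumes "x \<in> ell2"
  shows "L2_set (\<lambda>n. norm (x n)) {..<N} \<le> ell2_norm x"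
  using assms unfolding L2_set_def ell2_norm_def ell2_def
  by (auto intro!: real_sqrt_le_mono sum_le_suminf)

lemma ell2_boundI:
  assumes "\<And>N. L2_set (\<lambda>n. norm (x n)) {..<N} \<le> B"
  shows "x \<in> ell2" "ell2_norm x \<le> B"
proof -
  have B: "0 \<le> B" using assms[of 0] by simp
  have le: "(\<Sum>n<N. (norm (x n))\<^sup>2) \<le> B\<^sup>2" for N
    using assms[of N] unfolding L2_set_def by (metis real_sqrt_le_iff real_sqrt_unique B)
  have sm: "summable (\<lambda>n. (norm (x n))\<^sup>2)"
    by (rule bounded_imp_summable[of _ "B\<^sup>2"]) (use le[of "Suc _"] in \<open>auto simp: lessThan_Suc_atMost\<close>)
  then show "x \<in> ell2" by (simp add: ell2_def)
  show "ell2_norm x \<le> B"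
    unfolding ell2_norm_def
    by (rule real_le_lsqrt) (use B le sm in \<open>auto intro!: suminf_le_const suminf_nonneg\<close>)
qed

text \<open>Minkowski's inequality on finite sections. Three dominating sequences are what the
  quasi-additivity of \<open>KP_map\<close> calls for.\<close>

lemma ell2_dominated:
  assumes x: "x \<in> ell2" "y \<in> ell2" "w \<in> ell2" and nn: "0 \<le> a" "0 \<le> b" "0 \<le> c"
    and le: "\<And>n. norm (z n) \<le> a * norm (x n) + b * norm (y n) + c * norm (w n)"
  shows "z \<in> ell2" "ell2_norm z \<le> a * ell2_norm x + b * ell2_norm y + c * ell2_norm w"
proof -
  have *: "L2_set (\<lambda>n. norm (z n)) {..<N} \<le> a * ell2_norm x + b * ell2_norm y + c * ell2_norm w" for N
  proof -
    have "L2_set (\<lambda>n. norm (z n)) {..<N}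
      \<le> L2_set (\<lambda>n. (a * norm (x n) + b * norm (y n)) + c * norm (w n)) {..<N}"
      by (rule L2_set_mono) (use le in auto)
    also have "\<dots> \<le> (L2_set (\<lambda>n. a * norm (x n)) {..<N} + L2_set (\<lambda>n. b * norm (y n)) {..<N})
       + L2_set (\<lambda>n. c * norm (w n)) {..<N}"
      by (intro order.trans[OF L2_set_triangle_ineq] add_mono L2_set_triangle_ineq order.refl)
    also have "\<dots> = a * L2_set (\<lambda>n. norm (x n)) {..<N} + b * L2_set (\<lambda>n. norm (y n)) {..<N}
       + c * L2_set (\<lambda>n. norm (w n)) {..<N}"
      using nn by (simp add: L2_set_right_distrib)
    also have "\<dots> \<le> a * ell2_norm x + b * ell2_norm y + c * ell2_norm w"
      by (intro add_mono mult_left_mono ell2_bound_partial x nn)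
    finally show ?thesis .
  qed
  show "z \<in> ell2" "ell2_norm z \<le> a * ell2_norm x + b * ell2_norm y + c * ell2_norm w"
    using ell2_boundI[OF *] by auto
qed

lemma ell2_zero [simp]: "0 \<in> ell2" "ell2_norm 0 = 0"
  by (simp_all add: ell2_def ell2_norm_def)

lemma ell2_norm_nonneg: "x \<in> ell2 \<Longrightarrow> 0 \<le> ell2_norm x"
  using ell2_bound_partial[of x 0] by simp

text \<open>Estimating the logarithm of the square root gives a bound that tends to 0 with
  \<open>t\<close>, from which the coordinates of \<open>KP_map y\<close> are seen to tend to
  0.\<close>

lemma mult_ln_divide_le_sqrt:
  fixes t M :: real
  assumes "0 \<le> t" "t \<le> M"
  shows "\<bar>t * ln (M / t)\<bar> \<le> 2 * sqrt (M * t)"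
proof (cases "t = 0")
  case False
  then have t: "0 < t" "0 < M" "1 \<le> M / t" using assms by auto
  have "ln (M / t) = 2 * ln (sqrt (M / t))"
    using t by (simp add: ln_sqrt)
  also have "\<dots> \<le> 2 * sqrt (M / t)"
    using t ln_le_minus_one[of "sqrt (M / t)"] by simp
  finally have "t * ln (M / t) \<le> t * (2 * sqrt (M / t))"
    using t by (intro mult_left_mono) auto
  also have "t * (2 * sqrt (M / t)) = 2 * sqrt (M * t)"
    using t by (simp add: real_sqrt_divide real_sqrt_mult field_simps)
  finally show ?thesis using t by (simp add: abs_mult)
qed simp

lemma ell2_norm_coord:
  assumes "x \<in> ell2" shows "norm (x n) \<le> ell2_norm x"
proof -
  have "norm (x n) \<le> L2_set (\<lambda>n. norm (x n)) {..<Suc n}"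
    by (rule member_le_L2_set) auto
  then show ?thesis using ell2_bound_partial[OF assms, of "Suc n"] by linarith
qed

lemma ell2_add:
  assumes "x \<in> ell2" "y \<in> ell2"
  shows "x + y \<in> ell2" "ell2_norm (x + y) \<le> ell2_norm x + ell2_norm y"
  using ell2_dominated[OF assms assms(1), of 1 1 0 "x + y"] by (auto simp: norm_triangle_ineq)

lemma ell2_scale:
  assumes "x \<in> ell2"
  shows "(\<lambda>n. c * x n) \<in> ell2"
  using ell2_dominated(1)[OF assms assms assms, of "norm c" 0 0 "\<lambda>n. c * x n"] by (auto simp: norm_mult)

lemma ell2_cong_norm:
  assumes "x \<in> ell2" "\<And>n. norm (z n) = norm (x n)"
  shows "z \<in> ell2" "ell2_norm z = ell2_norm x"
  using assms by (simp_all add: ell2_def ell2_norm_def)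

lemma ell2_uminus:
  assumes "x \<in> ell2" shows "- x \<in> ell2" "ell2_norm (- x) = ell2_norm x"
  using ell2_cong_norm[OF assms, of "- x"] by auto

lemma ell2_diff:
  assumes "x \<in> ell2" "y \<in> ell2"
  shows "x - y \<in> ell2" "ell2_norm (x - y) \<le> ell2_norm x + ell2_norm y"
  using ell2_add[OF assms(1) ell2_uminus(1)[OF assms(2)]] ell2_uminus(2)[OF assms(2)] by auto

lemma ell2_Cauchy_Schwarz:
  assumes "x \<in> ell2" "y \<in> ell2"
  shows "summable (\<lambda>n. norm (x n) * norm (y n))"
    and "(\<Sum>n. norm (x n) * norm (y n)) \<le> ell2_norm x * ell2_norm y"
proof -
  have *: "(\<Sum>n<N. norm (x n) * norm (y n)) \<le> ell2_norm x * ell2_norm y" for N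
  proof -
    have "(\<Sum>n<N. norm (x n) * norm (y n)) \<le> L2_set (\<lambda>n. norm (x n)) {..<N} * L2_set (\<lambda>n. norm (y n)) {..<N}"
      using L2_set_mult_ineq[of "\<lambda>n. norm (x n)" "\<lambda>n. norm (y n)" "{..<N}"] by simp
    also have "\<dots> \<le> ell2_norm x * ell2_norm y"
      by (intro mult_mono ell2_bound_partial assms) (auto simp: ell2_norm_nonneg assms)
    finally show ?thesis .
  qed
  show sm: "summable (\<lambda>n. norm (x n) * norm (y n))"
    by (rule bounded_imp_summable[of _ "ell2_norm x * ell2_norm y"])
       (use *[of "Suc _"] in \<open>auto simp: lessThan_Suc_atMost\<close>)
  show "(\<Sum>n. norm (x n) * norm (y n)) \<le> ell2_norm x * ell2_norm y"
    by (rule suminf_le_const[OF sm *])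
qed

lemma ell2_norm_sq:
  assumes "x \<in> ell2"
  shows "(\<lambda>n. (norm (x n))\<^sup>2) sums (ell2_norm x)\<^sup>2"
  using assms unfolding ell2_norm_def ell2_def by (simp add: suminf_nonneg summable_sums)

subsection \<open>The quasi-norm\<close>

lemma KP_map_zero [simp]: "KP_map 0 = 0"
  by (simp add: KP_map_def fun_eq_iff)

lemma KP_map_coord:
  assumes "y \<in> ell2" shows "norm (KP_map y n) \<le> ell2_norm y"
proof (cases "y n = 0")
  case True
  then show ?thesis by (simp add: KP_map_def ell2_norm_nonneg[OF assms])
next
  case False
  then show ?thesis
    using mult_ln_divide_le[of "norm (y n)" "ell2_norm y"] ell2_norm_coord[OF assms, of n]
    by (simp add: KP_map_def norm_mult abs_mult)
qed

text \<open>All three normalisations are replaced by the common \<open>M = A + B\<close>. The terms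
  with \<open>ln M\<close> are linear and cancel, the terms \<open>\<kappa>\<close> are controlled
  by \<open>xlnx_quasi_additive\<close> and give \<open>3 * M\<close>, and the three corrections
  have norm at most \<open>M\<close> each because \<open>A * ln (M / A) \<le> M\<close>.\<close>

lemma KP_map_quasi_additive:
  assumes y: "y \<in> ell2" "y' \<in> ell2"
  shows "KP_map (y + y') - KP_map y - KP_map y' \<in> ell2"
    and "ell2_norm (KP_map (y + y') - KP_map y - KP_map y') \<le> 6 * (ell2_norm y + ell2_norm y')"
proof -
  define A B D where "A = ell2_norm y" and "B = ell2_norm y'" and "D = ell2_norm (y + y')"
  define M where "M = A + B"
  define \<kappa> where "\<kappa> c = c * of_real (ln (norm c))" for c :: 'a
  have nn: "0 \<le> A" "0 \<le> B" "0 \<le> D" "D \<le> M"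
    using y ell2_add[OF y] by (auto simp: A_def B_def D_def M_def ell2_norm_nonneg)
  have split: "KP_map v n = v n * of_real (ln M) - v n * of_real (ln (M / ell2_norm v)) - \<kappa> (v n)"
    if v: "v \<in> ell2" "ell2_norm v \<le> M" for v n
  proof (cases "v n = 0")
    case False
    then have "0 < norm (v n)" by simp
    then have "0 < ell2_norm v" "0 < M"
      using ell2_norm_coord[OF v(1), of n] v(2) by linarith+
    with False show ?thesis by (simp add: KP_map_def \<kappa>_def ln_div algebra_simps)
  qed (simp add: KP_map_def \<kappa>_def)
  let ?Z = "KP_map (y + y') - KP_map y - KP_map y'"
  let ?l = "\<lambda>c. \<bar>ln (M / c)\<bar>"
  have bd: "norm (?Z n) \<le> ?l D * norm ((y + y') n) + (3 + ?l A) * norm (y n) + (3 + ?l B) * norm (y' n)" for n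
  proof -
    have e1: "KP_map (y + y') n = (y n + y' n) * of_real (ln M) - (y n + y' n) * of_real (ln (M / D)) - \<kappa> (y n + y' n)"
      using split[of "y + y'" n] ell2_add(1)[OF y] nn by (simp only: D_def plus_fun_apply)
    have e2: "KP_map y n = y n * of_real (ln M) - y n * of_real (ln (M / A)) - \<kappa> (y n)"
      using split[of y n] y nn by (simp add: A_def M_def B_def)
    have e3: "KP_map y' n = y' n * of_real (ln M) - y' n * of_real (ln (M / B)) - \<kappa> (y' n)"
      using split[of y' n] y nn by (simp add: A_def M_def B_def)
    have "?Z n = - (\<kappa> (y n + y' n) - \<kappa> (y n) - \<kappa> (y' n))
        - (y + y') n * of_real (ln (M / D)) + y n * of_real (ln (M / A)) + y' n * of_real (ln (M / B))"
      unfolding minus_apply e1 e2 e3 by (simp add: algebra_simps)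
    also have "norm \<dots> \<le> norm (- (\<kappa> (y n + y' n) - \<kappa> (y n) - \<kappa> (y' n)))
        + norm ((y + y') n * of_real (ln (M / D))) + norm (y n * of_real (ln (M / A)))
        + norm (y' n * of_real (ln (M / B)))"
      by (intro order.trans[OF norm_triangle_ineq] order.trans[OF norm_triangle_ineq4] add_mono order.refl)
    also have "\<dots> \<le> 3 * (norm (y n) + norm (y' n))
        + norm ((y + y') n * of_real (ln (M / D))) + norm (y n * of_real (ln (M / A)))
        + norm (y' n * of_real (ln (M / B)))"
      using xlnx_quasi_additive[of "y n" "y' n"] unfolding \<kappa>_def norm_minus_cancel by linarith
    finally have "norm (?Z n) \<le> 3 * (norm (y n) + norm (y' n)) + norm ((y + y') n) * ?l D
        + norm (y n) * ?l A + norm (y' n) * ?l B"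
      by (simp only: norm_mult norm_of_real)
    then show ?thesis by (simp only: distrib_left distrib_right mult.commute add_ac)
  qed
  show "?Z \<in> ell2"
    by (rule ell2_dominated(1)[OF ell2_add(1)[OF y] y _ _ _ bd]) auto
  have "ell2_norm ?Z \<le> ?l D * D + (3 + ?l A) * A + (3 + ?l B) * B"
    unfolding A_def B_def D_def
    by (rule ell2_dominated(2)[OF ell2_add(1)[OF y] y _ _ _ bd[unfolded A_def B_def D_def]]) auto
  also have "\<dots> \<le> M + (3 * A + M) + (3 * B + M)"
    using mult_ln_divide_le[of D M] mult_ln_divide_le[of A M] mult_ln_divide_le[of B M] nn
    by (simp add: M_def abs_mult algebra_simps)
  finally show "ell2_norm ?Z \<le> 6 * (ell2_norm y + ell2_norm y')"
    by (simp add: M_def A_def B_def)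
qed

lemma Z2_iff: "u \<in> Z2 \<longleftrightarrow> snd u \<in> ell2 \<and> fst u - KP_map (snd u) \<in> ell2"
  by (auto simp: Z2_def split: prod.splits)

text \<open>The constant is 7 = 1 + 6: the norms add, and the failure of additivity of
  \<open>KP_map\<close> contributes the factor 6.\<close>

lemma Z2_add:
  assumes u: "u \<in> Z2" "v \<in> Z2"
  shows "u + v \<in> Z2" "Z2_qnorm (u + v) \<le> 7 * (Z2_qnorm u + Z2_qnorm v)"
proof -
  define a b where "a = fst u - KP_map (snd u)" and "b = fst v - KP_map (snd v)"
  define z where "z = KP_map (snd u + snd v) - KP_map (snd u) - KP_map (snd v)"
  have ab: "a \<in> ell2" "b \<in> ell2" "snd u \<in> ell2" "snd v \<in> ell2"
    using u by (auto simp: Z2_iff a_def b_def)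
  note z = KP_map_quasi_additive[OF ab(3,4), folded z_def]
  have eq: "fst (u + v) - KP_map (snd (u + v)) = a + b - z"
    by (simp add: a_def b_def z_def)
  show "u + v \<in> Z2"
    unfolding Z2_iff eq using ell2_diff(1)[OF ell2_add(1)[OF ab(1,2)] z(1)] ell2_add(1)[OF ab(3,4)] by simp
  have "ell2_norm (a + b - z) \<le> ell2_norm a + ell2_norm b + 6 * (ell2_norm (snd u) + ell2_norm (snd v))"
    using ell2_diff(2)[OF ell2_add(1)[OF ab(1,2)] z(1)] ell2_add(2)[OF ab(1,2)] z(2) by linarith
  then show "Z2_qnorm (u + v) \<le> 7 * (Z2_qnorm u + Z2_qnorm v)"
    using ell2_add(2)[OF ab(3,4)] ab[THEN ell2_norm_nonneg]
    unfolding Z2_qnorm_def eq a_def[symmetric] b_def[symmetric] by simp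
qed

lemma Z2_qnorm_scale: "u \<in> Z2 \<Longrightarrow> Z2_qnorm (seq_scale c u) = norm c * Z2_qnorm u"
  using Z2_equivalent_norm_qnorm unfolding Z2_equivalent_norm_def by blast

lemma Z2_scale:
  assumes "u \<in> Z2" shows "seq_scale c u \<in> Z2"
proof -
  have "(\<lambda>n. c * fst u n) - (\<lambda>n. c * KP_map (snd u) n) = (\<lambda>n. c * (fst u - KP_map (snd u)) n)"
    by (simp add: fun_eq_iff algebra_simps)
  then show ?thesis
    using assms ell2_scale[of "fst u - KP_map (snd u)" c] by (simp add: Z2_iff seq_scale_def KP_map_mult ell2_scale)
qed

lemma Z2_zero [simp]: "0 \<in> Z2" "Z2_qnorm 0 = 0"
  by (simp_all add: Z2_iff Z2_qnorm_def)

lemma Z2_subspace: "seq_pair.subspace Z2"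
  by (simp add: seq_pair.subspace_def Z2_add Z2_scale)

lemma Z2_qnorm_nonneg: "u \<in> Z2 \<Longrightarrow> 0 \<le> Z2_qnorm u"
  by (simp add: Z2_iff Z2_qnorm_def ell2_norm_nonneg)

lemma Z2_diff:
  assumes "u \<in> Z2" "v \<in> Z2"
  shows "u - v \<in> Z2" "Z2_qnorm (u - v) \<le> 7 * (Z2_qnorm u + Z2_qnorm v)"
proof -
  have eq: "u - v = u + seq_scale (- 1) v"
    by (simp add: seq_scale_def prod_eq_iff fun_eq_iff)
  show "u - v \<in> Z2" "Z2_qnorm (u - v) \<le> 7 * (Z2_qnorm u + Z2_qnorm v)"
    unfolding eq using Z2_add[OF assms(1) Z2_scale[OF assms(2), of "- 1"]] Z2_qnorm_scale[OF assms(2), of "- 1"]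
    by (simp_all only: norm_minus_cancel norm_one mult_1)
qed

text \<open>Coordinates are continuous for the quasi-norm. In the first component
  \<open>KP_map (snd u)\<close> is split off; its coordinates are bounded by the norm of
  \<open>snd u\<close>.\<close>

lemma Z2_coord:
  assumes "u \<in> Z2"
  shows "norm (snd u n) \<le> Z2_qnorm u" "norm (fst u n) \<le> 2 * Z2_qnorm u"
proof -
  have e: "snd u \<in> ell2" "fst u - KP_map (snd u) \<in> ell2" using assms by (auto simp: Z2_iff)
  note nn = e[THEN ell2_norm_nonneg]
  show "norm (snd u n) \<le> Z2_qnorm u"
    using ell2_norm_coord[OF e(1), of n] nn by (simp add: Z2_qnorm_def)
  have "norm (fst u n) \<le> norm ((fst u - KP_map (snd u)) n) + norm (KP_map (snd u) n)"
    using norm_triangle_ineq[of "(fst u - KP_map (snd u)) n" "KP_map (snd u) n"] by simp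
  then show "norm (fst u n) \<le> 2 * Z2_qnorm u"
    using ell2_norm_coord[OF e(2), of n] KP_map_coord[OF e(1), of n] nn by (simp add: Z2_qnorm_def)
qed

lemma Z2_qnorm_eq_0:
  assumes "u \<in> Z2" "Z2_qnorm u = 0" shows "u = 0"
  using Z2_coord[OF assms(1)] assms(2) by (auto simp: fun_eq_iff prod_eq_iff)

lemma Z2_fst_embed:
  assumes "x \<in> ell2" shows "(x, 0) \<in> Z2" "Z2_qnorm (x, 0) = ell2_norm x"
  using assms by (simp_all add: Z2_iff Z2_qnorm_def)

text \<open>A nonlinear lift of the second component that costs no quasi-norm; such pairs serve as
  test vectors.\<close>

lemma Z2_KP_map_embed:
  assumes "y \<in> ell2" shows "(KP_map y, y) \<in> Z2" "Z2_qnorm (KP_map y, y) = ell2_norm y"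
  using assms by (simp_all add: Z2_iff Z2_qnorm_def)

lemma ell2_tendsto_0: "y \<in> ell2 \<Longrightarrow> y \<longlonglongrightarrow> 0"
  unfolding ell2_def using summable_LIMSEQ_zero[of "\<lambda>n. (norm (y n))\<^sup>2"]
  by (simp add: tendsto_norm_zero_iff)

text \<open>Square summability settles \<open>snd u\<close> and
  \<open>fst u - KP_map (snd u)\<close>; the square root bound carries the convergence over to
  \<open>KP_map (snd u)\<close>.\<close>

lemma Z2_coord_tendsto_0:
  assumes "u \<in> Z2"
  shows "snd u \<longlonglongrightarrow> 0" "fst u \<longlonglongrightarrow> 0"
proof -
  have e: "snd u \<in> ell2" "fst u - KP_map (snd u) \<in> ell2" using assms by (auto simp: Z2_iff)
  show s: "snd u \<longlonglongrightarrow> 0" by (rule ell2_tendsto_0[OF e(1)])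
  define A where "A = ell2_norm (snd u)"
  have "norm (KP_map (snd u) n) \<le> 2 * sqrt (A * norm (snd u n))" for n
  proof (cases "snd u n = 0")
    case False
    then have "norm (KP_map (snd u) n) = \<bar>norm (snd u n) * ln (A / norm (snd u n))\<bar>"
      by (simp only: KP_map_def A_def norm_mult norm_of_real abs_mult abs_norm_cancel if_False)
    then show ?thesis
      using mult_ln_divide_le_sqrt[of "norm (snd u n)" A] ell2_norm_coord[OF e(1), of n] A_def by simp
  qed (simp add: KP_map_def)
  moreover have "(\<lambda>n. 2 * sqrt (A * norm (snd u n))) \<longlonglongrightarrow> 2 * sqrt (A * norm (0::'a))"
    using s by (intro tendsto_intros) (simp add: zero_fun_def)
  ultimately have "KP_map (snd u) \<longlonglongrightarrow> 0"
    using Lim_null_comparison[of "KP_map (snd u)" "\<lambda>n. 2 * sqrt (A * norm (snd u n))" sequentially] by simp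
  from tendsto_add[OF ell2_tendsto_0[OF e(2)] this] show "fst u \<longlonglongrightarrow> 0" by simp
qed

subsection \<open>The symplectic form\<close>

text \<open>Dividing by the norms leaves only the difference \<open>ln t - ln s\<close> of
  logarithms of normalised moduli, to which \<open>mult_ln_quotient_le\<close> applies. Over all
  \<open>n\<close> the squares on the right add up to at most 2.\<close>

lemma Z2_form_term_bound:
  assumes "y \<in> ell2" "y' \<in> ell2"
  shows "norm (KP_map y n * conj (y' n) - y n * conj (KP_map y' n))
    \<le> ell2_norm y * ell2_norm y' * ((norm (y n) / ell2_norm y)\<^sup>2 + (norm (y' n) / ell2_norm y')\<^sup>2)"
proof (cases "y n = 0 \<or> y' n = 0")
  case True
  then show ?thesis using assms by (auto simp: KP_map_def ell2_norm_nonneg)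
next
  case False
  define A B where "A = ell2_norm y" and "B = ell2_norm y'"
  have pos0: "0 < norm (y n)" "0 < norm (y' n)"
    using False by auto
  then have pos: "0 < A" "0 < B" "0 < norm (y n)" "0 < norm (y' n)"
    using ell2_norm_coord[OF assms(1), of n] ell2_norm_coord[OF assms(2), of n]
    unfolding A_def B_def by linarith+
  define s t where "s = norm (y n) / A" and "t = norm (y' n) / B"
  have st: "0 < s" "0 < t" using pos by (auto simp: s_def t_def)
  have "KP_map y n * conj (y' n) - y n * conj (KP_map y' n)
    = y n * conj (y' n) * of_real (ln (A / norm (y n)) - ln (B / norm (y' n)))"
    using False by (simp add: KP_map_def conj_mult A_def B_def algebra_simps)
  also have "norm \<dots> = norm (y n) * norm (y' n) * \<bar>ln (A / norm (y n)) - ln (B / norm (y' n))\<bar>"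
    by (simp only: norm_mult norm_conj norm_of_real)
  also have "ln (A / norm (y n)) - ln (B / norm (y' n)) = ln t - ln s"
    using pos by (simp add: s_def t_def ln_div)
  also have "norm (y n) * norm (y' n) = A * B * (s * t)"
    using pos by (simp add: s_def t_def)
  also have "A * B * (s * t) * \<bar>ln t - ln s\<bar> \<le> A * B * (s\<^sup>2 + t\<^sup>2)"
    using mult_ln_quotient_le[OF st] pos by (simp add: abs_minus_commute mult.assoc)
  finally show ?thesis by (simp add: A_def B_def s_def t_def)
qed

text \<open>With \<open>a\<close> and \<open>a'\<close> split off, the form consists of two scalar
  products, bounded by Cauchy-Schwarz, and of the logarithmic terms of
  \<open>Z2_form_term_bound\<close>.\<close>

lemma Z2_form_summable_bound:
  assumes "u \<in> Z2" "v \<in> Z2"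
  shows "summable (\<lambda>n. norm (fst u n * conj (snd v n) - snd u n * conj (fst v n)))"
    and "(\<Sum>n. norm (fst u n * conj (snd v n) - snd u n * conj (fst v n))) \<le> 2 * Z2_qnorm u * Z2_qnorm v"
proof -
  obtain x y x' y' where uv: "u = (x, y)" "v = (x', y')" by (metis surj_pair)
  define a a' where "a = x - KP_map y" and "a' = x' - KP_map y'"
  have e: "y \<in> ell2" "y' \<in> ell2" "a \<in> ell2" "a' \<in> ell2"
    using assms by (auto simp: Z2_iff uv a_def a'_def)
  define A B where "A = ell2_norm y" and "B = ell2_norm y'"
  have nn: "0 \<le> A" "0 \<le> B" "0 \<le> ell2_norm a" "0 \<le> ell2_norm a'"
    using e[THEN ell2_norm_nonneg] by (auto simp: A_def B_def)
  define g where "g n = norm (a n) * norm (y' n) + norm (y n) * norm (a' n)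
     + A * B * ((norm (y n) / A)\<^sup>2 + (norm (y' n) / B)\<^sup>2)" for n
  have le: "norm (x n * conj (y' n) - y n * conj (x' n)) \<le> g n" for n
  proof -
    have "x n * conj (y' n) - y n * conj (x' n) = a n * conj (y' n) - y n * conj (a' n)
       + (KP_map y n * conj (y' n) - y n * conj (KP_map y' n))"
      by (simp add: a_def a'_def conj_diff algebra_simps)
    also have "norm \<dots> \<le> norm (a n * conj (y' n)) + norm (y n * conj (a' n))
       + norm (KP_map y n * conj (y' n) - y n * conj (KP_map y' n))"
      by (intro order.trans[OF norm_triangle_ineq] add_mono order.refl norm_triangle_ineq4)
    also have "\<dots> \<le> g n"
      using Z2_form_term_bound[OF e(1,2), of n] by (simp add: g_def A_def B_def norm_mult)
    finally show ?thesis .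
  qed
  note CS1 = ell2_Cauchy_Schwarz[OF e(3,2)] and CS2 = ell2_Cauchy_Schwarz[OF e(1,4)]
  \<comment> \<open>The quotient is left unsimplified: it is 1 unless \<open>w\<close> has norm 0,
    in which case division by zero makes it 0.\<close>
  have n1: "(\<lambda>n. (norm (w n) / ell2_norm w)\<^sup>2) sums ((ell2_norm w)\<^sup>2 / (ell2_norm w)\<^sup>2)" if "w \<in> ell2" for w :: "nat \<Rightarrow> 'a"
    using sums_divide[OF ell2_norm_sq[OF that], of "(ell2_norm w)\<^sup>2"] by (simp add: power_divide)
  have s3: "(\<lambda>n. A * B * ((norm (y n) / A)\<^sup>2 + (norm (y' n) / B)\<^sup>2)) sums (A * B * (A\<^sup>2 / A\<^sup>2 + B\<^sup>2 / B\<^sup>2))"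
    unfolding A_def B_def by (intro sums_mult sums_add n1 e)
  have gs: "g sums ((\<Sum>n. norm (a n) * norm (y' n)) + (\<Sum>n. norm (y n) * norm (a' n))
       + A * B * (A\<^sup>2 / A\<^sup>2 + B\<^sup>2 / B\<^sup>2))"
    unfolding g_def by (intro sums_add s3 summable_sums CS1 CS2)
  show sm: "summable (\<lambda>n. norm (fst u n * conj (snd v n) - snd u n * conj (fst v n)))"
    by (rule summable_comparison_test'[OF sums_summable[OF gs], of 0]) (use le in \<open>simp add: uv\<close>)
  have "A * B * (A\<^sup>2 / A\<^sup>2 + B\<^sup>2 / B\<^sup>2) \<le> A * B * 2"
    using nn by (intro mult_left_mono) auto
  then have "suminf g \<le> ell2_norm a * B + A * ell2_norm a' + 2 * A * B"
    using CS1(2) CS2(2) sums_unique[OF gs, symmetric] unfolding A_def B_def by linarith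
  also have "\<dots> \<le> 2 * (ell2_norm a + A) * (ell2_norm a' + B)"
    using nn by (simp add: algebra_simps)
  finally have "suminf g \<le> 2 * Z2_qnorm u * Z2_qnorm v"
    by (simp add: Z2_qnorm_def uv a_def a'_def A_def B_def)
  then show "(\<Sum>n. norm (fst u n * conj (snd v n) - snd u n * conj (fst v n))) \<le> 2 * Z2_qnorm u * Z2_qnorm v"
    using suminf_le[OF _ sm sums_summable[OF gs]] le by (simp add: uv)
qed

lemma Z2_form_sums:
  assumes "u \<in> Z2" "v \<in> Z2"
  shows "(\<lambda>n. fst u n * conj (snd v n) - snd u n * conj (fst v n)) sums Z2_form u v"
  unfolding Z2_form_def
  by (rule summable_sums[OF summable_norm_cancel[OF Z2_form_summable_bound(1)[OF assms]]])

lemma Z2_form_bound: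
  assumes "u \<in> Z2" "v \<in> Z2"
  shows "norm (Z2_form u v) \<le> 2 * Z2_qnorm u * Z2_qnorm v"
  unfolding Z2_form_def
  using summable_norm[OF Z2_form_summable_bound(1)[OF assms]] Z2_form_summable_bound(2)[OF assms] by linarith

lemma Z2_form_add:
  assumes "u \<in> Z2" "u' \<in> Z2" "v \<in> Z2"
  shows "Z2_form (u + u') v = Z2_form u v + Z2_form u' v"
    and "Z2_form v (u + u') = Z2_form v u + Z2_form v u'"
proof -
  have "(\<lambda>n. fst (u + u') n * conj (snd v n) - snd (u + u') n * conj (fst v n)) =
    (\<lambda>n. (fst u n * conj (snd v n) - snd u n * conj (fst v n)) + (fst u' n * conj (snd v n) - snd u' n * conj (fst v n)))"
    by (simp add: fun_eq_iff algebra_simps)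
  then show "Z2_form (u + u') v = Z2_form u v + Z2_form u' v"
    using sums_add[OF Z2_form_sums[OF assms(1,3)] Z2_form_sums[OF assms(2,3)]]
    by (simp only: Z2_form_def sums_iff)
  have "(\<lambda>n. fst v n * conj (snd (u + u') n) - snd v n * conj (fst (u + u') n)) =
    (\<lambda>n. (fst v n * conj (snd u n) - snd v n * conj (fst u n)) + (fst v n * conj (snd u' n) - snd v n * conj (fst u' n)))"
    by (simp add: fun_eq_iff algebra_simps conj_add)
  then show "Z2_form v (u + u') = Z2_form v u + Z2_form v u'"
    using sums_add[OF Z2_form_sums[OF assms(3,1)] Z2_form_sums[OF assms(3,2)]]
    by (simp only: Z2_form_def sums_iff)
qed

lemma Z2_form_scale:
  assumes "u \<in> Z2" "v \<in> Z2"
  shows "Z2_form (seq_scale c u) v = c * Z2_form u v"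
    and "Z2_form u (seq_scale c v) = conj c * Z2_form u v"
proof -
  have "(\<lambda>n. fst (seq_scale c u) n * conj (snd v n) - snd (seq_scale c u) n * conj (fst v n)) =
    (\<lambda>n. c * (fst u n * conj (snd v n) - snd u n * conj (fst v n)))"
    by (simp add: fun_eq_iff seq_scale_def algebra_simps)
  then show "Z2_form (seq_scale c u) v = c * Z2_form u v"
    using sums_mult[OF Z2_form_sums[OF assms], of c]
    by (simp only: Z2_form_def sums_iff)
  have "(\<lambda>n. fst u n * conj (snd (seq_scale c v) n) - snd u n * conj (fst (seq_scale c v) n)) =
    (\<lambda>n. conj c * (fst u n * conj (snd v n) - snd u n * conj (fst v n)))"
    by (simp add: fun_eq_iff seq_scale_def conj_mult algebra_simps)
  then show "Z2_form u (seq_scale c v) = conj c * Z2_form u v"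
    using sums_mult[OF Z2_form_sums[OF assms], of "conj c"]
    by (simp only: Z2_form_def sums_iff)
qed

section \<open>Unit vectors and flat vectors\<close>

definition unit_seq :: "nat \<Rightarrow> nat \<Rightarrow> 'k::real_or_complex" where
  "unit_seq i = (\<lambda>n. if n = i then 1 else 0)"

definition unit_fst :: "nat \<Rightarrow> 'k::real_or_complex seq_pair" where
  "unit_fst i = (unit_seq i, 0)"

definition unit_snd :: "nat \<Rightarrow> 'k::real_or_complex seq_pair" where
  "unit_snd i = (0, unit_seq i)"

lemma seq_scale_simps [simp]:
  "fst (seq_scale c u) n = c * fst u n" "snd (seq_scale c u) n = c * snd u n"
  by (simp_all add: seq_scale_def)

lemma sum_fun_at: "(sum f A) n = (\<Sum>a\<in>A. f a n)"
  for f :: "'a \<Rightarrow> 'b \<Rightarrow> 'c::comm_monoid_add"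
  by (induction A rule: infinite_finite_induct) auto

lemma unit_seq_ell2:
  "(unit_seq i :: nat \<Rightarrow> 'a::real_or_complex) \<in> ell2" "ell2_norm (unit_seq i :: nat \<Rightarrow> 'a) = 1"
proof -
  have "(\<lambda>n. (norm (unit_seq i n :: 'a))\<^sup>2) = (\<lambda>n. if n = i then 1 else 0)"
    by (auto simp: unit_seq_def)
  then have "(\<lambda>n. (norm (unit_seq i n :: 'a))\<^sup>2) sums 1"
    using sums_single[of i "\<lambda>_. 1::real"] by simp
  then show "unit_seq i \<in> (ell2 :: (nat \<Rightarrow> 'a) set)" "ell2_norm (unit_seq i :: nat \<Rightarrow> 'a) = 1"
    by (auto simp: ell2_def ell2_norm_def sums_iff)
qed

lemma KP_map_unit_seq: "KP_map (unit_seq i) = 0"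
  by (auto simp: KP_map_def unit_seq_ell2 fun_eq_iff) (auto simp: unit_seq_def split: if_splits)

lemma unit_fst_Z2:
  "(unit_fst i :: 'k::real_or_complex seq_pair) \<in> Z2" "Z2_qnorm (unit_fst i :: 'k seq_pair) = 1"
  by (simp_all add: unit_fst_def Z2_fst_embed unit_seq_ell2)

lemma unit_snd_Z2:
  "(unit_snd i :: 'k::real_or_complex seq_pair) \<in> Z2" "Z2_qnorm (unit_snd i :: 'k seq_pair) = 1"
  using Z2_KP_map_embed[OF unit_seq_ell2(1)[of i]]
  by (simp_all add: unit_snd_def KP_map_unit_seq unit_seq_ell2)

text \<open>Unit vectors read off coordinates through the form, so a bound on the form bounds every
  matrix entry of an operator.\<close>

lemma Z2_form_unit:
  "Z2_form w (unit_fst i) = - snd w i" "Z2_form w (unit_snd i) = fst w i"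
proof -
  have "Z2_form w (unit_fst i) = (\<Sum>n. if n = i then - snd w n else 0)"
    unfolding Z2_form_def by (intro arg_cong[where f = suminf]) (auto simp: unit_fst_def unit_seq_def)
  then show "Z2_form w (unit_fst i) = - snd w i"
    using sums_unique[OF sums_single[of i "\<lambda>n. - snd w n"]] by simp
  have "Z2_form w (unit_snd i) = (\<Sum>n. if n = i then fst w n else 0)"
    unfolding Z2_form_def by (intro arg_cong[where f = suminf]) (auto simp: unit_snd_def unit_seq_def)
  then show "Z2_form w (unit_snd i) = fst w i"
    using sums_unique[OF sums_single[of i "\<lambda>n. fst w n"]] by simp
qed

lemma Z2_form_flat:
  assumes "w \<in> Z2"
  shows "Z2_form w (seq_scale (of_real L) (unit_fst i) + unit_snd i) = fst w i - of_real L * snd w i"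
  using assms by (simp add: Z2_form_add Z2_form_scale Z2_scale unit_fst_Z2 unit_snd_Z2 Z2_form_unit)

lemma Z2_sum: "(\<And>k. k \<in> A \<Longrightarrow> w k \<in> Z2) \<Longrightarrow> (\<Sum>k\<in>A. seq_scale (c k) (w k)) \<in> Z2"
  by (intro seq_pair.subspace_sum[OF Z2_subspace] Z2_scale)

text \<open>The second component has modulus \<open>1 / sqrt N\<close> at \<open>N\<close> distinct
  places, hence norm 1, so \<open>KP_map\<close> multiplies it by \<open>ln (sqrt N) = L\<close>.
  The first component is exactly this multiple, so \<open>u\<close> is a pair
  \<open>(KP_map y, y)\<close>, whose quasi-norm is that of \<open>y\<close>.\<close>

lemma flat_vector_Z2:
  fixes c :: "'a \<Rightarrow> 'k::real_or_complex"
  assumes A: "finite A" "A \<noteq> {}" "inj_on j A" and c: "\<And>k. k \<in> A \<Longrightarrow> norm (c k) = 1"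
    and N: "N = real (card A)" and L: "L = ln (sqrt N)"
  defines "u \<equiv> \<Sum>k\<in>A. seq_scale (c k / of_real (sqrt N)) (seq_scale (of_real L) (unit_fst (j k)) + unit_snd (j k))"
  shows "u \<in> Z2" "Z2_qnorm u = 1"
proof -
  show "u \<in> Z2" unfolding u_def
    by (rule Z2_sum) (simp add: Z2_add Z2_scale unit_fst_Z2 unit_snd_Z2)
  have N0: "0 < N" using A by (simp add: N card_gt_0_iff)
  have s: "snd u n = (\<Sum>k\<in>A. if n = j k then c k / of_real (sqrt N) else 0)" for n
    by (simp add: u_def snd_sum sum_fun_at seq_scale_def unit_fst_def unit_snd_def unit_seq_def if_distrib cong: if_cong)
  have f: "fst u n = of_real L * snd u n" for n
    unfolding s sum_distrib_left
    by (auto simp: u_def fst_sum sum_fun_at seq_scale_def unit_fst_def unit_snd_def unit_seq_def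
        intro!: sum.cong)
  \<comment> \<open>Injectivity of \<open>j\<close> keeps different coefficients from meeting at one
    coordinate.\<close>
  have at: "snd u (j k) = c k / of_real (sqrt N)" if "k \<in> A" for k
  proof -
    have "snd u (j k) = (\<Sum>k'\<in>A. if k' = k then c k' / of_real (sqrt N) else 0)"
      unfolding s by (rule sum.cong) (use A(3) that in \<open>auto simp: inj_on_def\<close>)
    then show ?thesis using A(1) that by simp
  qed
  have off: "snd u n = 0" if "n \<notin> j ` A" for n
    unfolding s by (rule sum.neutral) (use that in auto)
  have nrm: "norm (snd u n) = (if n \<in> j ` A then 1 / sqrt N else 0)" for n
    using at off c N0 by (auto simp: norm_divide)
  have "(\<lambda>n. (norm (snd u n))\<^sup>2) sums (\<Sum>n\<in>j ` A. (norm (snd u n))\<^sup>2)"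
    by (rule sums_finite) (use A off in auto)
  also have "(\<Sum>n\<in>j ` A. (norm (snd u n))\<^sup>2) = (\<Sum>n\<in>j ` A. 1 / N)"
    using N0 by (intro sum.cong) (auto simp: nrm power_divide)
  also have "\<dots> = 1"
    using A N0 by (simp add: card_image N)
  finally have e: "snd u \<in> ell2" "ell2_norm (snd u) = 1"
    by (auto simp: ell2_def ell2_norm_def sums_iff)
  have "fst u = KP_map (snd u)"
  proof
    fix n
    have "n \<in> j ` A \<Longrightarrow> snd u n \<noteq> 0" using nrm[of n] N0 by auto
    then show "fst u n = KP_map (snd u) n"
      unfolding f KP_map_def e nrm using off[of n] by (auto simp: L)
  qed
  then show "Z2_qnorm u = 1" by (simp add: Z2_qnorm_def e)
qed

subsection \<open>Bounded operators\<close>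

definition qnorm_bound :: "('k::real_or_complex seq_pair \<Rightarrow> 'k seq_pair) \<Rightarrow> real \<Rightarrow> bool" where
  "qnorm_bound T C \<longleftrightarrow> (\<forall>u\<in>Z2. Z2_qnorm (T u) \<le> C * Z2_qnorm u)"

lemma Z2_operatorsD:
  assumes "T \<in> Z2_operators"
  shows "u \<in> Z2 \<Longrightarrow> T u \<in> Z2" "u \<notin> Z2 \<Longrightarrow> T u = 0"
    "u \<in> Z2 \<Longrightarrow> v \<in> Z2 \<Longrightarrow> T (u + v) = T u + T v"
    "u \<in> Z2 \<Longrightarrow> T (seq_scale c u) = seq_scale c (T u)"
    "\<exists>C. qnorm_bound T C"
  using assms unfolding Z2_operators_def qnorm_bound_def by (blast, blast, blast, blast, blast)

lemma qnorm_bound_nonneg: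
  assumes "T \<in> Z2_operators" "qnorm_bound T C" shows "0 \<le> C"
  using assms(2)[unfolded qnorm_bound_def, rule_format, OF unit_fst_Z2(1)[of 0]]
    Z2_qnorm_nonneg[OF Z2_operatorsD(1)[OF assms(1) unit_fst_Z2(1)[of 0]]]
  by (simp add: unit_fst_Z2)

lemma Z2_operator_zero:
  assumes "T \<in> Z2_operators" shows "T 0 = 0"
proof -
  have "T (seq_scale 0 0) = seq_scale 0 (T 0)"
    by (rule Z2_operatorsD(4)[OF assms Z2_zero(1)])
  then show ?thesis by (simp add: seq_pair.scale_zero_left)
qed

lemma Z2_operator_sum:
  assumes T: "T \<in> Z2_operators" and w: "\<And>k. k \<in> A \<Longrightarrow> w k \<in> Z2"
  shows "T (\<Sum>k\<in>A. seq_scale (c k) (w k)) = (\<Sum>k\<in>A. seq_scale (c k) (T (w k)))"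
  using w
proof (induction A rule: infinite_finite_induct)
  case (insert x A)
  then show ?case
    by (simp add: Z2_operatorsD(3,4)[OF T] Z2_scale Z2_sum)
qed (simp_all add: Z2_operator_zero[OF T])

lemma Z2_form_sum:
  assumes w: "\<And>k. k \<in> A \<Longrightarrow> w k \<in> Z2" and v: "v \<in> Z2"
  shows "Z2_form (\<Sum>k\<in>A. seq_scale (c k) (w k)) v = (\<Sum>k\<in>A. c k * Z2_form (w k) v)"
    and "Z2_form v (\<Sum>k\<in>A. seq_scale (c k) (w k)) = (\<Sum>k\<in>A. conj (c k) * Z2_form v (w k))"
proof -
  have "Z2_form (\<Sum>k\<in>A. seq_scale (c k) (w k)) v = (\<Sum>k\<in>A. c k * Z2_form (w k) v) \<and>
    Z2_form v (\<Sum>k\<in>A. seq_scale (c k) (w k)) = (\<Sum>k\<in>A. conj (c k) * Z2_form v (w k))"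
    using w
  proof (induction A rule: infinite_finite_induct)
    case (insert x A)
    then show ?case
      by (simp add: Z2_form_add Z2_form_scale Z2_scale Z2_sum v)
  qed (simp_all add: Z2_form_def)
  then show "Z2_form (\<Sum>k\<in>A. seq_scale (c k) (w k)) v = (\<Sum>k\<in>A. c k * Z2_form (w k) v)"
    "Z2_form v (\<Sum>k\<in>A. seq_scale (c k) (w k)) = (\<Sum>k\<in>A. conj (c k) * Z2_form v (w k))"
    by auto
qed

lemma operator_form_sum:
  assumes T: "T \<in> Z2_operators" and wz: "\<And>k. w k \<in> Z2" "\<And>k. z k \<in> Z2"
  shows "Z2_form (T (\<Sum>k\<in>A. seq_scale (a k) (w k))) (\<Sum>m\<in>B. seq_scale (b m) (z m))
    = (\<Sum>k\<in>A. \<Sum>m\<in>B. a k * conj (b m) * Z2_form (T (w k)) (z m))"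
proof -
  have Tw: "T (w k) \<in> Z2" for k by (rule Z2_operatorsD(1)[OF T wz(1)])
  have z: "(\<Sum>m\<in>B. seq_scale (b m) (z m)) \<in> Z2" by (rule Z2_sum[OF wz(2)])
  show ?thesis
    unfolding Z2_operator_sum[OF T wz(1)] Z2_form_sum(1)[of A "\<lambda>k. T (w k)", OF Tw z]
      Z2_form_sum(2)[of B z, OF wz(2) Tw] sum_distrib_left mult.assoc ..
qed

lemma operator_flat:
  assumes "T \<in> Z2_operators"
  shows "T (seq_scale c (unit_fst j) + unit_snd j) = seq_scale c (T (unit_fst j)) + T (unit_snd j)"
  by (simp only: Z2_operatorsD(3,4)[OF assms] Z2_scale unit_fst_Z2(1) unit_snd_Z2(1))

lemma operator_form_bound:
  assumes T: "T \<in> Z2_operators" "qnorm_bound T C" and uv: "u \<in> Z2" "v \<in> Z2"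
  shows "norm (Z2_form (T u) v) \<le> 2 * C * Z2_qnorm u * Z2_qnorm v"
proof -
  have "norm (Z2_form (T u) v) \<le> 2 * Z2_qnorm (T u) * Z2_qnorm v"
    by (rule Z2_form_bound[OF Z2_operatorsD(1)[OF T(1) uv(1)] uv(2)])
  also have "\<dots> \<le> 2 * (C * Z2_qnorm u) * Z2_qnorm v"
  proof (rule mult_right_mono[OF mult_left_mono])
    show "Z2_qnorm (T u) \<le> C * Z2_qnorm u"
      using T(2) uv(1) unfolding qnorm_bound_def by blast
  qed (use Z2_qnorm_nonneg[OF uv(2)] in simp_all)
  finally show ?thesis by (simp add: mult.assoc)
qed

text \<open>Up to sign, each entry of the two by two block matrix of \<open>T\<close> is the form of
  the image of a unit vector with a unit vector.\<close>

lemma operator_entry_bound: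
  assumes T: "T \<in> Z2_operators" "qnorm_bound T C"
  shows "norm (fst (T (unit_fst j)) i) \<le> 2 * C" "norm (snd (T (unit_fst j)) i) \<le> 2 * C"
    "norm (fst (T (unit_snd j)) i) \<le> 2 * C" "norm (snd (T (unit_snd j)) i) \<le> 2 * C"
proof -
  note b = operator_form_bound[OF T]
  note E = unit_fst_Z2(1)[of i] unit_snd_Z2(1)[of i] and E' = unit_fst_Z2(1)[of j] unit_snd_Z2(1)[of j]
  note s = Z2_form_unit norm_minus_cancel unit_fst_Z2(2) unit_snd_Z2(2) mult_1_right
  show "norm (snd (T (unit_fst j)) i) \<le> 2 * C"
    using b[OF E'(1) E(1)] by (simp only: s)
  show "norm (fst (T (unit_fst j)) i) \<le> 2 * C"
    using b[OF E'(1) E(2)] by (simp only: s)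
  show "norm (snd (T (unit_snd j)) i) \<le> 2 * C"
    using b[OF E'(2) E(1)] by (simp only: s)
  show "norm (fst (T (unit_snd j)) i) \<le> 2 * C"
    using b[OF E'(2) E(2)] by (simp only: s)
qed

section \<open>Averaging and symmetry estimates on finite sets of coordinates\<close>

text \<open>\<open>T\<close> is tested between flat vectors carried by the images of
  \<open>A\<close> under \<open>j\<close> and \<open>i\<close>. The expressions to be bounded are
  the diagonal terms of the resulting double sum; phases make them nonnegative, and
  \<open>sign_choice\<close> keeps the other terms from lowering the sum. The form is at most
  \<open>2 * C\<close>, and the factor \<open>N\<close> undoes the normalisation of the two
  vectors.\<close>

lemma diagonal_sum_bound:
  fixes T :: "'k::real_or_complex seq_pair \<Rightarrow> 'k seq_pair"
  assumes T: "T \<in> Z2_operators" "qnorm_bound T C"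
    and A: "finite A" "A \<noteq> {}" "inj_on i A" "inj_on j A"
    and N: "N = real (card A)" and L: "L = ln (sqrt N)"
  shows "(\<Sum>k\<in>A. norm (fst (T (unit_snd (j k))) (i k)
      + of_real L * (fst (T (unit_fst (j k))) (i k) - snd (T (unit_snd (j k))) (i k))
      - of_real (L\<^sup>2) * snd (T (unit_fst (j k))) (i k))) \<le> 2 * C * N" (is "(\<Sum>k\<in>A. norm (?D k)) \<le> _")
proof -
  define w where "w k = seq_scale (of_real L) (unit_fst (j k)) + (unit_snd (j k) :: 'k seq_pair)" for k
  define z where "z k = seq_scale (of_real L) (unit_fst (i k)) + (unit_snd (i k) :: 'k seq_pair)" for k
  have wz: "w k \<in> Z2" "z k \<in> Z2" for k
    unfolding w_def z_def by (intro Z2_add(1) Z2_scale unit_fst_Z2(1) unit_snd_Z2(1))+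
  note Tin = Z2_operatorsD(1)[OF T(1)]
  have N0: "0 < N" using A by (simp add: N card_gt_0_iff)
  have D: "Z2_form (T (w k)) (z k) = ?D k" for k
    unfolding z_def Z2_form_flat[OF Tin[OF wz(1)]] unfolding w_def operator_flat[OF T(1)]
    by (simp add: power2_eq_square algebra_simps)
  \<comment> \<open>The phases replace the diagonal terms by their moduli and keep \<open>v\<close>
    flat.\<close>
  obtain \<theta> where th: "\<And>k. norm (\<theta> k) = 1" "\<And>k. ?D k * conj (\<theta> k) = of_real (norm (?D k))"
  proof -
    have "\<forall>k. \<exists>t. norm t = 1 \<and> ?D k * conj t = of_real (norm (?D k))"
      by (meson exists_phase)
    then show ?thesis using that by metis
  qed
  define B where "B k m = conj (\<theta> m) * Z2_form (T (w k)) (z m)" for k m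
  obtain s :: "'a \<Rightarrow> real" where s: "\<And>a. \<bar>s a\<bar> = 1"
    and le: "norm (\<Sum>a\<in>A. B a a) \<le> norm (\<Sum>a\<in>A. \<Sum>b\<in>A. of_real (s a * s b) * B a b)"
    using sign_choice[OF A(1), of 0 B] by auto
  \<comment> \<open>The same signs occur in \<open>u\<close> and \<open>v\<close>, so they square to
    1 on the diagonal.\<close>
  define u where "u = (\<Sum>k\<in>A. seq_scale (of_real (s k) / of_real (sqrt N)) (w k))"
  define v where "v = (\<Sum>k\<in>A. seq_scale (of_real (s k) * \<theta> k / of_real (sqrt N)) (z k))"
  have u: "u \<in> Z2" "Z2_qnorm u = 1"
    using flat_vector_Z2[OF A(1,2,4) _ N L, of "\<lambda>k. of_real (s k)"] s by (auto simp: u_def w_def)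
  have v: "v \<in> Z2" "Z2_qnorm v = 1"
    using flat_vector_Z2[OF A(1,2,3) _ N L, of "\<lambda>k. of_real (s k) * \<theta> k"] s
    by (auto simp: v_def z_def norm_mult th)
  have "Z2_form (T u) v = (\<Sum>a\<in>A. \<Sum>b\<in>A. of_real (s a * s b) * B a b) / of_real N"
  proof -
    have "of_real (s b) * \<theta> b / of_real (sqrt N) = of_real (s b / sqrt N) * \<theta> b" for b
      by simp
    then have c: "conj (of_real (s b) * \<theta> b / of_real (sqrt N)) = of_real (s b / sqrt N) * conj (\<theta> b)" for b
      by (simp only: conj_mult conj_of_real)
    have N': "of_real N = (of_real (sqrt N) * of_real (sqrt N) :: 'k)"
      using N0 by (simp flip: of_real_mult)
    have "Z2_form (T u) v = (\<Sum>a\<in>A. \<Sum>b\<in>A. of_real (s a) / of_real (sqrt N)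
        * (of_real (s b / sqrt N) * conj (\<theta> b)) * Z2_form (T (w a)) (z b))"
      unfolding u_def v_def operator_form_sum[OF T(1) wz] c ..
    also have "\<dots> = (\<Sum>a\<in>A. \<Sum>b\<in>A. of_real (s a * s b) * B a b / of_real N)"
      by (intro sum.cong refl) (simp add: B_def N')
    finally show ?thesis by (simp add: sum_divide_distrib)
  qed
  then have "norm (\<Sum>a\<in>A. \<Sum>b\<in>A. of_real (s a * s b) * B a b) = N * norm (Z2_form (T u) v)"
    using N0 by (simp add: norm_divide)
  also have "\<dots> \<le> N * (2 * C)"
    using operator_form_bound[OF T u(1) v(1)] N0 by (simp add: u v)
  finally have "norm (\<Sum>a\<in>A. B a a) \<le> 2 * C * N" using le by (simp add: mult_ac)
  moreover have "(\<Sum>a\<in>A. B a a) = of_real (\<Sum>a\<in>A. norm (?D a))"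
    unfolding B_def D of_real_sum by (intro sum.cong refl) (subst mult.commute, rule th(2))
  then have "norm (\<Sum>a\<in>A. B a a) = (\<Sum>a\<in>A. norm (?D a))"
    by (simp only: norm_of_real abs_of_nonneg sum_nonneg norm_ge_zero)
  ultimately show ?thesis by linarith
qed

text \<open>\<open>g i\<close> is the flat vector whose signs are row \<open>i\<close> of
  \<open>h\<close>. The forms of \<open>T (g i)\<close> with \<open>unit_snd i\<close> and of
  \<open>T (unit_snd i)\<close> with \<open>g i\<close> are at most \<open>2 * C\<close> each.
  Summed over \<open>i\<close>, both contain the entries from the second to the first component with
  the same weights, because \<open>h\<close> is symmetric. Their difference retains only the terms
  with the factor \<open>L\<close>.\<close>

lemma symmetric_sum_bound:
  fixes T :: "'k::real_or_complex seq_pair \<Rightarrow> 'k seq_pair"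
  assumes T: "T \<in> Z2_operators" "qnorm_bound T C"
    and A: "finite A" "A \<noteq> {}" and N: "N = real (card A)" and L: "L = ln (sqrt N)"
    and h: "\<And>i j. i \<in> A \<Longrightarrow> j \<in> A \<Longrightarrow> \<bar>h i j\<bar> = 1" "\<And>i j. h i j = h j i"
  shows "norm (of_real L * (\<Sum>i\<in>A. \<Sum>j\<in>A. of_real (h i j / sqrt N) *
      (fst (T (unit_fst j)) i + snd (T (unit_snd i)) j))) \<le> 4 * C * N"
proof -
  define g :: "nat \<Rightarrow> 'k seq_pair" where
    "g i = (\<Sum>j\<in>A. seq_scale (of_real (h i j) / of_real (sqrt N)) (seq_scale (of_real L) (unit_fst j) + unit_snd j))" for i
  have g: "g i \<in> Z2" "Z2_qnorm (g i) = 1" if "i \<in> A" for i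
    using flat_vector_Z2[OF A inj_on_id _ N L, of "\<lambda>j. of_real (h i j)"] h(1)[OF that] unfolding g_def by simp_all
  note Tin = Z2_operatorsD(1)[OF T(1)]
  have c: "of_real x / of_real y = (of_real (x / y) :: 'k)" for x y by simp
  \<comment> \<open>The cancellation in isolation: \<open>b\<close> and \<open>c\<close> stand for
    the two sums of entries from the second to the first component.\<close>
  have rearrange: "z = x - y" if "b = c" "x = a + b" "y = c - d" "z = a + d" for a b c d x y z :: 'k
    using that by simp
  define H where "H i j = (of_real (h i j / sqrt N) :: 'k)" for i j
  have conj_H: "conj (H i j) = H i j" and H_sym: "H i j = H j i" for i j
    using h(2)[of i j] unfolding H_def conj_of_real by simp_all
  have fl: "seq_scale (of_real L) (unit_fst j) + unit_snd j \<in> Z2" for j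
    by (intro Z2_add(1) Z2_scale unit_fst_Z2(1) unit_snd_Z2(1))
  have 1: "Z2_form (T (g i)) (unit_snd i)
     = of_real L * (\<Sum>j\<in>A. H i j * fst (T (unit_fst j)) i) + (\<Sum>j\<in>A. H i j * fst (T (unit_snd j)) i)" for i
    unfolding g_def c H_def[symmetric] Z2_operator_sum[OF T(1) fl] operator_flat[OF T(1)] Z2_form_unit
    by (simp add: fst_sum sum_fun_at sum_distrib_left sum.distrib distrib_left mult.left_commute)
  have 2: "Z2_form (T (unit_snd i)) (g i)
     = (\<Sum>j\<in>A. H i j * fst (T (unit_snd i)) j) - of_real L * (\<Sum>j\<in>A. H i j * snd (T (unit_snd i)) j)" for i
    unfolding g_def c H_def[symmetric] Z2_form_sum(2)[OF fl Tin[OF unit_snd_Z2(1)]] conj_H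
      Z2_form_flat[OF Tin[OF unit_snd_Z2(1)]]
    by (simp add: sum_subtractf right_diff_distrib sum_distrib_left mult.left_commute)
  have "(\<Sum>i\<in>A. \<Sum>j\<in>A. H i j * fst (T (unit_snd j)) i) = (\<Sum>j\<in>A. \<Sum>i\<in>A. H j i * fst (T (unit_snd j)) i)"
    by (subst sum.swap) (simp only: H_sym)
  moreover have "(\<Sum>i\<in>A. Z2_form (T (g i)) (unit_snd i))
    = of_real L * (\<Sum>i\<in>A. \<Sum>j\<in>A. H i j * fst (T (unit_fst j)) i) + (\<Sum>i\<in>A. \<Sum>j\<in>A. H i j * fst (T (unit_snd j)) i)"
    unfolding 1 sum.distrib sum_distrib_left[of "of_real L" _ A] ..
  moreover have "(\<Sum>i\<in>A. Z2_form (T (unit_snd i)) (g i))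
    = (\<Sum>i\<in>A. \<Sum>j\<in>A. H i j * fst (T (unit_snd i)) j) - of_real L * (\<Sum>i\<in>A. \<Sum>j\<in>A. H i j * snd (T (unit_snd i)) j)"
    unfolding 2 sum_subtractf sum_distrib_left[of "of_real L" _ A] ..
  moreover have "of_real L * (\<Sum>i\<in>A. \<Sum>j\<in>A. H i j * (fst (T (unit_fst j)) i + snd (T (unit_snd i)) j))
    = of_real L * (\<Sum>i\<in>A. \<Sum>j\<in>A. H i j * fst (T (unit_fst j)) i)
    + of_real L * (\<Sum>i\<in>A. \<Sum>j\<in>A. H i j * snd (T (unit_snd i)) j)"
    unfolding sum.distrib distrib_left ..
  ultimately have "of_real L * (\<Sum>i\<in>A. \<Sum>j\<in>A. H i j * (fst (T (unit_fst j)) i + snd (T (unit_snd i)) j))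
    = (\<Sum>i\<in>A. Z2_form (T (g i)) (unit_snd i)) - (\<Sum>i\<in>A. Z2_form (T (unit_snd i)) (g i))"
    by (rule rearrange)
  also have "norm \<dots> \<le> norm (\<Sum>i\<in>A. Z2_form (T (g i)) (unit_snd i)) + norm (\<Sum>i\<in>A. Z2_form (T (unit_snd i)) (g i))"
    by (rule norm_triangle_ineq4)
  also have "\<dots> \<le> (\<Sum>i\<in>A. 2 * C) + (\<Sum>i\<in>A. 2 * C)"
  proof (rule add_mono; rule sum_norm_le)
    fix i assume "i \<in> A"
    note gi = g[OF this]
    show "norm (Z2_form (T (g i)) (unit_snd i)) \<le> 2 * C"
      using operator_form_bound[OF T gi(1) unit_snd_Z2(1)] unfolding gi(2) unit_snd_Z2(2) by simp
    show "norm (Z2_form (T (unit_snd i)) (g i)) \<le> 2 * C"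
      using operator_form_bound[OF T unit_snd_Z2(1) gi(1)] unfolding gi(2) unit_snd_Z2(2) by simp
  qed
  finally have "norm (of_real L * (\<Sum>i\<in>A. \<Sum>j\<in>A. H i j * (fst (T (unit_fst j)) i + snd (T (unit_snd i)) j))) \<le> 4 * C * N"
    by (simp add: N)
  then show ?thesis by (simp only: H_def)
qed

section \<open>Limits of matrix entries of bounded operators\<close>

lemma not_tendsto_0_infinite:
  fixes f :: "nat \<Rightarrow> 'a::real_normed_vector"
  assumes "\<not> f \<longlonglongrightarrow> 0"
  obtains \<delta> where "0 < \<delta>" "infinite {k. \<delta> \<le> norm (f k)}"
proof -
  obtain \<delta> where d: "0 < \<delta>" "\<forall>n. \<exists>k\<ge>n. \<not> norm (f k) < \<delta>"
    using assms unfolding LIMSEQ_iff by auto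
  have "infinite {k. \<delta> \<le> norm (f k)}"
    unfolding infinite_nat_iff_unbounded_le using d(2) by (auto simp: not_less)
  with d(1) show ?thesis by (rule that)
qed

lemma exists_large_log:
  obtains n :: nat where "0 < n" "R \<le> ln (sqrt (real n))"
proof -
  obtain n :: nat where n: "exp (2 * R) < real n" using reals_Archimedean2 by blast
  then have "0 < real n" using exp_gt_zero[of "2 * R"] by linarith
  with n have "2 * R < ln (real n)" by (metis exp_less_cancel_iff exp_ln)
  with \<open>0 < real n\<close> show ?thesis by (intro that[of n]) (auto simp: ln_sqrt)
qed

text \<open>Over \<open>n\<close> indices from \<open>S\<close> the full expression of
  \<open>diagonal_sum_bound\<close> has average at most \<open>2 * C\<close>. Its term without a
  factor \<open>L\<close> is itself at most \<open>2 * C\<close> and is dropped at that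
  cost.\<close>

lemma diagonal_entries_bound:
  fixes T :: "'k::real_or_complex seq_pair \<Rightarrow> 'k seq_pair"
  assumes T: "T \<in> Z2_operators" "qnorm_bound T C" and ij: "inj i" "inj j"
    and S: "infinite S" and n: "0 < n" and L: "L = ln (sqrt (real n))"
    and d: "\<And>k. k \<in> S \<Longrightarrow> d \<le> norm (of_real L * (fst (T (unit_fst (j k))) (i k) - snd (T (unit_snd (j k))) (i k))
      - of_real (L\<^sup>2) * snd (T (unit_fst (j k))) (i k))"
  shows "d \<le> 4 * C"
proof -
  obtain A where A: "finite A" "card A = n" "A \<subseteq> S"
    using infinite_arbitrarily_large[OF S] by blast
  let ?r = "\<lambda>k. fst (T (unit_snd (j k))) (i k)"
  let ?x = "\<lambda>k. of_real L * (fst (T (unit_fst (j k))) (i k) - snd (T (unit_snd (j k))) (i k))"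
  let ?y = "\<lambda>k. of_real (L\<^sup>2) * snd (T (unit_fst (j k))) (i k)"
  have "d - 2 * C \<le> norm (?r k + ?x k - ?y k)" if "k \<in> A" for k
  proof -
    have "norm (?x k - ?y k) \<le> norm (?r k + ?x k - ?y k) + norm (?r k)"
      using norm_triangle_ineq4[of "?r k + ?x k - ?y k" "?r k"] by simp
    then show ?thesis
      using d[of k] operator_entry_bound(3)[OF T, of "j k" "i k"] A that by fastforce
  qed
  then have "real n * (d - 2 * C) \<le> (\<Sum>k\<in>A. norm (?r k + ?x k - ?y k))"
    using sum_bounded_below[of A "d - 2 * C"] A(2) by simp
  also have "\<dots> \<le> 2 * C * real n"
    by (rule diagonal_sum_bound[OF T A(1) _ _ _ _ L])
       (use A n ij in \<open>auto intro: inj_on_subset\<close>)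
  finally have "real n * d \<le> real n * (4 * C)"
    by (simp add: algebra_simps)
  with n show ?thesis by simp
qed

text \<open>These entries carry the factor \<open>L\<^sup>2\<close>, the diagonal ones only
  \<open>L\<close>. Entries of size \<delta> at infinitely many places would give
  \<open>L\<^sup>2 * \<delta> \<le> 4 * C * (L + 1)\<close> for arbitrarily large
  \<open>L\<close>.\<close>

lemma lower_entries_tendsto_0:
  fixes T :: "'k::real_or_complex seq_pair \<Rightarrow> 'k seq_pair"
  assumes T: "T \<in> Z2_operators" and ij: "inj i" "inj j"
  shows "(\<lambda>k. snd (T (unit_fst (j k))) (i k)) \<longlonglongrightarrow> 0"
proof (rule ccontr)
  assume "\<not> ?thesis"
  then obtain \<delta> where d: "0 < \<delta>" "infinite {k. \<delta> \<le> norm (snd (T (unit_fst (j k))) (i k))}"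
    by (rule not_tendsto_0_infinite)
  obtain C where C: "qnorm_bound T C" using Z2_operatorsD(5)[OF T] by blast
  have C0: "0 \<le> C" by (rule qnorm_bound_nonneg[OF T C])
  \<comment> \<open>With \<open>1 \<le> L\<close> and \<open>8 * C < L * \<delta>\<close> the
    quadratic term exceeds \<open>8 * C * L\<close>, which is at least
    \<open>4 * C * L + 4 * C\<close>.\<close>
  obtain n where n: "0 < n" "max 1 (8 * C / \<delta> + 1) \<le> ln (sqrt (real n))" by (rule exists_large_log)
  define L where "L = ln (sqrt (real n))"
  have "8 * C / \<delta> < L" using n(2) by (simp add: L_def)
  then have L: "1 \<le> L" "8 * C < L * \<delta>"
    using n(2) d(1) by (auto simp: L_def pos_divide_less_eq)
  have "L\<^sup>2 * \<delta> - L * (4 * C) \<le> 4 * C"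
  proof (rule diagonal_entries_bound[OF T C ij d(2) n(1) L_def])
    fix k assume k: "k \<in> {k. \<delta> \<le> norm (snd (T (unit_fst (j k))) (i k))}"
    let ?p = "fst (T (unit_fst (j k))) (i k)" and ?b = "snd (T (unit_snd (j k))) (i k)"
      and ?t = "snd (T (unit_fst (j k))) (i k)"
    have "norm (of_real L * (?p - ?b)) \<le> L * (4 * C)"
      using operator_entry_bound[OF T C, of "j k" "i k"] norm_triangle_ineq4[of ?p ?b] L(1)
      by (auto simp: norm_mult intro!: mult_left_mono)
    moreover have "L\<^sup>2 * \<delta> \<le> norm (of_real (L\<^sup>2) * ?t)"
      using k by (auto simp: norm_mult norm_power intro!: mult_left_mono)
    moreover have "norm (of_real (L\<^sup>2) * ?t) - norm (of_real L * (?p - ?b)) \<le> norm (of_real L * (?p - ?b) - of_real (L\<^sup>2) * ?t)"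
      by (metis norm_minus_commute norm_triangle_ineq2)
    ultimately show "L\<^sup>2 * \<delta> - L * (4 * C) \<le> norm (of_real L * (?p - ?b) - of_real (L\<^sup>2) * ?t)"
      by linarith
  qed
  moreover have "L * (8 * C) < L\<^sup>2 * \<delta>"
    using mult_strict_left_mono[OF L(2), of L] L(1) by (simp add: power2_eq_square mult_ac)
  moreover have "C \<le> L * C" using mult_right_mono[OF L(1) C0] by simp
  ultimately show False by simp
qed

text \<open>For fixed \<open>L\<close> the term with \<open>L\<^sup>2\<close> is negligible far out,
  by the preceding lemma, and the term linear in \<open>L\<close> takes over.\<close>

lemma diagonal_entries_diff_tendsto_0:
  fixes T :: "'k::real_or_complex seq_pair \<Rightarrow> 'k seq_pair"
  assumes T: "T \<in> Z2_operators" and ij: "inj i" "inj j"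
  shows "(\<lambda>k. fst (T (unit_fst (j k))) (i k) - snd (T (unit_snd (j k))) (i k)) \<longlonglongrightarrow> 0"
proof (rule ccontr)
  let ?d = "\<lambda>k. fst (T (unit_fst (j k))) (i k) - snd (T (unit_snd (j k))) (i k)"
  let ?t = "\<lambda>k. snd (T (unit_fst (j k))) (i k)"
  assume "\<not> ?thesis"
  then obtain \<delta> where d: "0 < \<delta>" "infinite {k. \<delta> \<le> norm (?d k)}"
    by (rule not_tendsto_0_infinite)
  obtain C where C: "qnorm_bound T C" using Z2_operatorsD(5)[OF T] by blast
  \<comment> \<open>\<open>L * \<delta>\<close> has to exceed \<open>4 * C + 1\<close>; the 1
    absorbs the quadratic term for \<open>k \<ge> K\<close>, where \<open>K\<close> is chosen after
    \<open>L\<close>.\<close>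
  obtain n where n: "0 < n" "max 1 ((4 * C + 2) / \<delta>) \<le> ln (sqrt (real n))" by (rule exists_large_log)
  define L where "L = ln (sqrt (real n))"
  have L: "1 \<le> L" "4 * C + 2 \<le> L * \<delta>"
    using n(2) d(1) by (auto simp: L_def pos_divide_le_eq)
  have "(\<lambda>k. norm (of_real (L\<^sup>2) * ?t k)) \<longlonglongrightarrow> norm (of_real (L\<^sup>2) * (0::'k))"
    by (intro tendsto_intros lower_entries_tendsto_0[OF T ij])
  then have "eventually (\<lambda>k. norm (of_real (L\<^sup>2) * ?t k) < 1) sequentially"
    by (rule order_tendstoD(2)) simp
  then obtain K where K: "\<And>k. K \<le> k \<Longrightarrow> norm (of_real (L\<^sup>2) * ?t k) < 1"
    by (auto simp: eventually_sequentially)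
  have "infinite ({k. \<delta> \<le> norm (?d k)} - {..<K})"
    using d(2) by simp
  then have "L * \<delta> - 1 \<le> 4 * C"
  proof (rule diagonal_entries_bound[OF T C ij _ n(1) L_def])
    fix k assume k: "k \<in> {k. \<delta> \<le> norm (?d k)} - {..<K}"
    have "L * \<delta> \<le> norm (of_real L * ?d k)"
      using k L(1) by (auto simp: norm_mult intro!: mult_left_mono)
    moreover have "norm (of_real L * ?d k) - norm (of_real (L\<^sup>2) * ?t k) \<le> norm (of_real L * ?d k - of_real (L\<^sup>2) * ?t k)"
      by (rule norm_triangle_ineq2)
    moreover have "norm (of_real (L\<^sup>2) * ?t k) < 1" using k by (intro K) auto
    ultimately show "L * \<delta> - 1 \<le> norm (of_real L * ?d k - of_real (L\<^sup>2) * ?t k)"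
      by linarith
  qed
  with L(2) show False by simp
qed

subsection \<open>Strictly singular operators\<close>

lemma truncation:
  fixes x :: "nat \<Rightarrow> 'k::real_or_complex"
  defines "z N \<equiv> (\<lambda>n. if n < N then x n else 0)"
  shows "z N \<in> ell2" "ell2_norm (z N) = L2_set (\<lambda>n. norm (x n)) {..<N}"
    "(z N, 0) = (\<Sum>k<N. seq_scale (x k) (unit_fst k))"
proof -
  have "(\<lambda>n. (norm (z N n))\<^sup>2) sums (\<Sum>n<N. (norm (z N n))\<^sup>2)"
    by (rule sums_finite) (auto simp: z_def)
  then show "z N \<in> ell2" "ell2_norm (z N) = L2_set (\<lambda>n. norm (x n)) {..<N}"
    by (auto simp: ell2_def ell2_norm_def L2_set_def sums_iff z_def)
  have "fst (\<Sum>k<N. seq_scale (x k) (unit_fst k)) n = z N n" for n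
    by (simp add: fst_sum sum_fun_at unit_fst_def unit_seq_def z_def if_distrib cong: if_cong)
  moreover have "snd (\<Sum>k<N. seq_scale (x k) (unit_fst k)) n = 0" for n
    by (simp add: snd_sum sum_fun_at unit_fst_def)
  ultimately show "(z N, 0) = (\<Sum>k<N. seq_scale (x k) (unit_fst k))"
    by (auto simp: prod_eq_iff fun_eq_iff)
qed

text \<open>A row acts as a bounded functional on the pairs \<open>(x, 0)\<close> with
  \<open>x\<close> in \<open>ell2\<close>. Testing it on finite sections of its own conjugate shows
  that it is square summable.\<close>

lemma operator_row_tendsto_0:
  fixes T :: "'k::real_or_complex seq_pair \<Rightarrow> 'k seq_pair"
  assumes T: "T \<in> Z2_operators"
  shows "(\<lambda>k. fst (T (unit_fst k)) a) \<longlonglongrightarrow> 0" "(\<lambda>k. snd (T (unit_fst k)) a) \<longlonglongrightarrow> 0"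
proof -
  obtain C where C: "qnorm_bound T C" using Z2_operatorsD(5)[OF T] by blast
  have *: "\<psi> \<longlonglongrightarrow> 0"
    if ps: "\<And>x N. norm (\<Sum>k<N. x k * \<psi> k) \<le> 2 * C * L2_set (\<lambda>n. norm (x n)) {..<N}" for \<psi> :: "nat \<Rightarrow> 'k"
  proof (rule ell2_tendsto_0, rule ell2_boundI(1))
    fix N
    define l where "l = L2_set (\<lambda>n. norm (\<psi> n)) {..<N}"
    have "(\<Sum>k<N. conj (\<psi> k) * \<psi> k) = of_real (\<Sum>k<N. (norm (\<psi> k))\<^sup>2)"
      by (simp add: mult.commute[of "conj _"] mult_conj scaleR_conv_of_real)
    also have "(\<Sum>k<N. (norm (\<psi> k))\<^sup>2) = l * l"
      by (simp add: l_def L2_set_def sum_nonneg)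
    finally have "l * l \<le> 2 * C * l"
      using ps[of "\<lambda>k. conj (\<psi> k)" N] by (simp add: l_def norm_mult)
    then show "l \<le> 2 * C"
      using qnorm_bound_nonneg[OF T C] by (cases "l = 0") (auto simp: l_def L2_set_nonneg order_less_le)
  qed
  have tr: "norm (\<Sum>k<N. x k * fst (T (unit_fst k)) a) \<le> 2 * C * L2_set (\<lambda>n. norm (x n)) {..<N} \<and>
    norm (\<Sum>k<N. x k * snd (T (unit_fst k)) a) \<le> 2 * C * L2_set (\<lambda>n. norm (x n)) {..<N}" for x N
  proof -
    let ?u = "(\<Sum>k<N. seq_scale (x k) (unit_fst k))"
    have u: "?u \<in> Z2" "Z2_qnorm ?u = L2_set (\<lambda>n. norm (x n)) {..<N}"
      using truncation(1,2)[of N x] unfolding truncation(3)[symmetric]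
      by (simp_all add: Z2_fst_embed)
    have "T ?u = (\<Sum>k<N. seq_scale (x k) (T (unit_fst k)))"
      by (rule Z2_operator_sum[OF T unit_fst_Z2(1)])
    then have "fst (T ?u) a = (\<Sum>k<N. x k * fst (T (unit_fst k)) a)" "snd (T ?u) a = (\<Sum>k<N. x k * snd (T (unit_fst k)) a)"
      by (simp_all add: fst_sum snd_sum sum_fun_at)
    moreover have "norm (fst (T ?u) a) \<le> 2 * C * Z2_qnorm ?u" "norm (snd (T ?u) a) \<le> 2 * C * Z2_qnorm ?u"
      using operator_form_bound[OF T C u(1) unit_snd_Z2(1)[of a]] operator_form_bound[OF T C u(1) unit_fst_Z2(1)[of a]]
      by (simp_all only: Z2_form_unit unit_fst_Z2(2) unit_snd_Z2(2) norm_minus_cancel mult_1_right)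
    ultimately show ?thesis using u(2) by simp
  qed
  show "(\<lambda>k. fst (T (unit_fst k)) a) \<longlonglongrightarrow> 0" "(\<lambda>k. snd (T (unit_fst k)) a) \<longlonglongrightarrow> 0"
    using tr by (auto intro!: *)
qed

text \<open>The tails of \<open>x\<close> tend to 0 in norm, and \<open>T\<close> followed by a
  coordinate is continuous, so the values on truncations converge.\<close>

lemma operator_row_sums:
  fixes T :: "'k::real_or_complex seq_pair \<Rightarrow> 'k seq_pair"
  assumes T: "T \<in> Z2_operators" and x: "x \<in> ell2"
  shows "(\<lambda>k. x k * fst (T (unit_fst k)) a) sums fst (T (x, 0)) a"
    "(\<lambda>k. x k * snd (T (unit_fst k)) a) sums snd (T (x, 0)) a"
proof -
  obtain C where C: "qnorm_bound T C" using Z2_operatorsD(5)[OF T] by blast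
  let ?z = "\<lambda>N n. if n < N then x n else 0"
  let ?w = "\<lambda>N n. if n < N then 0 else x n"
  have w: "?w N \<in> ell2" "ell2_norm (?w N) = sqrt ((ell2_norm x)\<^sup>2 - (\<Sum>n<N. (norm (x n))\<^sup>2))" for N
  proof -
    have "(\<lambda>n. (norm (x n))\<^sup>2 - (if n \<in> {..<N} then (norm (x n))\<^sup>2 else 0)) sums ((ell2_norm x)\<^sup>2 - (\<Sum>n<N. (norm (x n))\<^sup>2))"
      by (intro sums_diff ell2_norm_sq[OF x] sums_If_finite_set) simp
    moreover have "(\<lambda>n. (norm (x n))\<^sup>2 - (if n \<in> {..<N} then (norm (x n))\<^sup>2 else 0)) = (\<lambda>n. (norm (?w N n))\<^sup>2)"
      by auto
    ultimately show "?w N \<in> ell2" "ell2_norm (?w N) = sqrt ((ell2_norm x)\<^sup>2 - (\<Sum>n<N. (norm (x n))\<^sup>2))"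
      by (auto simp: ell2_def ell2_norm_def sums_iff)
  qed
  have "(\<lambda>N. 2 * C * sqrt ((ell2_norm x)\<^sup>2 - (\<Sum>n<N. (norm (x n))\<^sup>2))) \<longlonglongrightarrow> 2 * C * sqrt ((ell2_norm x)\<^sup>2 - (ell2_norm x)\<^sup>2)"
    by (intro tendsto_intros ell2_norm_sq[OF x, unfolded sums_def])
  then have lim: "(\<lambda>N. 2 * C * ell2_norm (?w N)) \<longlonglongrightarrow> 0"
    by (simp add: w(2))
  have split: "T (x, 0) = (\<Sum>k<N. seq_scale (x k) (T (unit_fst k))) + T (?w N, 0)" for N
  proof -
    have "(x, 0 :: nat \<Rightarrow> 'k) = (?z N, 0) + (?w N, 0)" by (auto simp: prod_eq_iff fun_eq_iff)
    then have "T (x, 0) = T (?z N, 0) + T (?w N, 0)"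
      using Z2_operatorsD(3)[OF T Z2_fst_embed(1)[OF truncation(1)] Z2_fst_embed(1)[OF w(1)]] by metis
    also have "T (?z N, 0) = (\<Sum>k<N. seq_scale (x k) (T (unit_fst k)))"
      unfolding truncation(3) by (rule Z2_operator_sum[OF T unit_fst_Z2(1)])
    finally show ?thesis .
  qed
  have bd: "norm (fst (T (?w N, 0)) a) \<le> 2 * C * ell2_norm (?w N)" "norm (snd (T (?w N, 0)) a) \<le> 2 * C * ell2_norm (?w N)" for N
    using operator_form_bound[OF T C Z2_fst_embed(1)[OF w(1)] unit_snd_Z2(1)[of a], of N]
      operator_form_bound[OF T C Z2_fst_embed(1)[OF w(1)] unit_fst_Z2(1)[of a], of N]
    by (simp_all only: Z2_form_unit unit_fst_Z2(2) unit_snd_Z2(2) norm_minus_cancel mult_1_right Z2_fst_embed(2)[OF w(1)])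
  have l: "(\<lambda>N. fst (T (?w N, 0)) a) \<longlonglongrightarrow> 0" "(\<lambda>N. snd (T (?w N, 0)) a) \<longlonglongrightarrow> 0"
    by (rule Lim_null_comparison[OF always_eventually lim], simp add: bd)+
  have "(\<lambda>N. fst (T (x, 0)) a - fst (T (?w N, 0)) a) \<longlonglongrightarrow> fst (T (x, 0)) a - 0"
    by (intro tendsto_diff tendsto_const l)
  moreover have "fst (T (x, 0)) a - fst (T (?w N, 0)) a = (\<Sum>k<N. x k * fst (T (unit_fst k)) a)" for N
    unfolding split[of N] by (simp add: fst_sum sum_fun_at)
  ultimately show "(\<lambda>k. x k * fst (T (unit_fst k)) a) sums fst (T (x, 0)) a"
    by (simp add: sums_def)
  have "(\<lambda>N. snd (T (x, 0)) a - snd (T (?w N, 0)) a) \<longlonglongrightarrow> snd (T (x, 0)) a - 0"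
    by (intro tendsto_diff tendsto_const l)
  moreover have "snd (T (x, 0)) a - snd (T (?w N, 0)) a = (\<Sum>k<N. x k * snd (T (unit_fst k)) a)" for N
    unfolding split[of N] by (simp add: snd_sum sum_fun_at)
  ultimately show "(\<lambda>k. x k * snd (T (unit_fst k)) a) sums snd (T (x, 0)) a"
    by (simp add: sums_def)
qed

section \<open>Copies of \<open>ell2\<close> in the first component\<close>

definition supported_subspace :: "nat set \<Rightarrow> 'k::real_or_complex seq_pair set" where
  "supported_subspace J = {u. fst u \<in> ell2 \<and> (\<forall>n. n \<notin> J \<longrightarrow> fst u n = 0) \<and> snd u = 0}"

lemma supported_subspace_Z2:
  assumes "u \<in> supported_subspace J"
  shows "u = (fst u, 0)" "u \<in> Z2" "Z2_qnorm u = ell2_norm (fst u)"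
proof -
  show u: "u = (fst u, 0)" using assms by (simp add: supported_subspace_def prod_eq_iff)
  show "u \<in> Z2" "Z2_qnorm u = ell2_norm (fst u)"
    using Z2_fst_embed[of "fst u"] assms u by (auto simp: supported_subspace_def)
qed

text \<open>Coordinates are continuous, so their vanishing survives limits. Once
  \<open>snd u\<close> is 0, membership in \<open>Z2\<close> says that \<open>fst u\<close> is
  square summable.\<close>

lemma closed_supported_subspace: "closed_subspace_Z2 (supported_subspace J :: 'k::real_or_complex seq_pair set)"
  unfolding closed_subspace_Z2_def
proof (intro conjI ballI impI)
  let ?M = "supported_subspace J :: 'k seq_pair set"
  show "?M \<subseteq> Z2" using supported_subspace_Z2 by blast
  show "seq_pair.subspace ?M"
    unfolding seq_pair.subspace_def
    by (auto simp: supported_subspace_def ell2_add fun_eq_iff seq_scale_def ell2_scale)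
  fix u :: "'k seq_pair" assume u: "u \<in> Z2" and ap: "\<forall>e>0. \<exists>m\<in>?M. Z2_qnorm (u - m) < e"
  have z: "z = 0" if "\<And>e. 0 < e \<Longrightarrow> norm z \<le> 2 * e" for z :: 'k
  proof (rule ccontr)
    assume "z \<noteq> 0"
    then show False using that[of "norm z / 4"] by simp
  qed
  have s: "snd u n = 0" for n
  proof (rule z)
    fix e :: real assume e: "0 < e"
    with ap obtain m where m: "m \<in> ?M" "Z2_qnorm (u - m) < e" by blast
    show "norm (snd u n) \<le> 2 * e"
      using Z2_coord(1)[OF Z2_diff(1)[OF u supported_subspace_Z2(2)[OF m(1)]], of n] m e
      by (simp add: supported_subspace_def)
  qed
  have f: "fst u n = 0" if n: "n \<notin> J" for n
  proof (rule z)
    fix e :: real assume e: "0 < e"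
    with ap obtain m where m: "m \<in> ?M" "Z2_qnorm (u - m) < e" by blast
    show "norm (fst u n) \<le> 2 * e"
      using Z2_coord(2)[OF Z2_diff(1)[OF u supported_subspace_Z2(2)[OF m(1)]], of n] m e n
      by (simp add: supported_subspace_def)
  qed
  have "snd u = 0" using s by (simp add: fun_eq_iff)
  then show "u \<in> ?M"
    using u f by (simp add: supported_subspace_def Z2_iff)
qed

lemma infinite_dimensional_supported_subspace:
  assumes "infinite J"
  shows "infinite_dimensional (supported_subspace J :: 'k::real_or_complex seq_pair set)"
  unfolding infinite_dimensional_def
proof
  let ?e = "unit_fst :: nat \<Rightarrow> 'k seq_pair"
  have inj: "inj ?e"
  proof (rule injI)
    fix a b assume "?e a = ?e b"
    then have "unit_seq a a = (unit_seq b a :: 'k)" by (simp add: unit_fst_def)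
    then show "a = b" by (simp add: unit_seq_def split: if_splits)
  qed
  have ind: "seq_pair.independent (?e ` J)"
    unfolding seq_pair.independent_explicit_finite_subsets
  proof (intro allI impI ballI)
    fix V f v
    assume V: "V \<subseteq> ?e ` J" "finite V" and sum: "(\<Sum>v\<in>V. seq_scale (f v) v) = 0" and v: "v \<in> V"
    obtain n where n: "v = ?e n" using V(1) v by blast
    have "0 = fst (\<Sum>v\<in>V. seq_scale (f v) v) n" by (simp only: sum fst_zero zero_fun_apply)
    also have "\<dots> = (\<Sum>w\<in>V. if w = v then f w else 0)"
      unfolding fst_sum sum_fun_at seq_scale_simps
    proof (rule sum.cong[OF refl])
      fix w assume "w \<in> V"
      then obtain m where m: "w = ?e m" using V(1) by blast
      then have "w = v \<longleftrightarrow> m = n" using n inj_eq[OF inj] by simp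
      then show "f w * fst w n = (if w = v then f w else 0)"
        by (simp add: m unit_fst_def unit_seq_def)
    qed
    also have "\<dots> = f v" using V(2) v by simp
    finally show "f v = 0" by simp
  qed
  assume "\<exists>B. finite B \<and> (supported_subspace J :: 'k seq_pair set) \<subseteq> seq_pair.span B"
  then obtain B where B: "finite B" "(supported_subspace J :: 'k seq_pair set) \<subseteq> seq_pair.span B" by blast
  have "?e ` J \<subseteq> supported_subspace J"
    by (auto simp: supported_subspace_def unit_fst_def unit_seq_ell2) (auto simp: unit_seq_def)
  then have "finite (?e ` J)"
    using seq_pair.independent_span_bound[OF B(1) ind] B(2) by blast
  then show False
    using assms finite_imageD[OF _ inj_on_subset[OF inj subset_UNIV]] by blast
qed

section \<open>The gliding hump argument\<close>

text \<open>Each new term has to meet finitely many eventual conditions relative to the earlier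
  ones. Demanding them for every \<open>a \<le> r n\<close>, not just for the chosen values, makes
  each choice depend on the previous term alone.\<close>

lemma sparse_subsequence:
  assumes "infinite K"
    and P: "\<And>q a. eventually (P q a) sequentially" and Q: "\<And>q. eventually (Q q) sequentially"
  obtains r :: "nat \<Rightarrow> nat" where "strict_mono r" "\<And>q. r q \<in> K" "\<And>q. Q q (r q)"
    "\<And>l q. l < q \<Longrightarrow> P q (r l) (r q)"
proof -
  have ex: "\<exists>y\<in>K. x < y \<and> R y" if ev: "eventually R sequentially" for R and x :: nat
  proof -
    obtain N where N: "\<forall>n\<ge>N. R n" using ev unfolding eventually_sequentially by blast
    obtain y where "y \<in> K" "max (Suc x) N \<le> y"
      using assms(1) unfolding infinite_nat_iff_unbounded_le by blast
    with N have "x < y" "R y" by auto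
    with \<open>y \<in> K\<close> show ?thesis by blast
  qed
  have "\<exists>r. \<forall>n. (r n \<in> K \<and> Q n (r n)) \<and> (r n < r (Suc n) \<and> (\<forall>a\<le>r n. P (Suc n) a (r (Suc n))))"
  proof (rule dependent_nat_choice)
    show "\<exists>x. x \<in> K \<and> Q 0 x" using ex[OF Q[of 0]] by blast
    fix x n
    have "eventually (\<lambda>y. Q (Suc n) y \<and> (\<forall>a\<in>{..x}. P (Suc n) a y)) sequentially"
      by (intro eventually_conj Q eventually_ball_finite ballI P finite_atMost)
    from ex[OF this, of x] show "\<exists>y. (y \<in> K \<and> Q (Suc n) y) \<and> x < y \<and> (\<forall>a\<le>x. P (Suc n) a y)"
      by auto
  qed
  then obtain r where r: "\<And>n. r n \<in> K" "\<And>n. Q n (r n)" "\<And>n. r n < r (Suc n)"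
    "\<And>n a. a \<le> r n \<Longrightarrow> P (Suc n) a (r (Suc n))" by blast
  have mono: "strict_mono r" using r(3) by (simp add: strict_mono_Suc_iff)
  have "P q (r l) (r q)" if lq: "l < q" for l q
  proof -
    obtain n where n: "q = Suc n" "l \<le> n" using lq by (cases q) auto
    then show ?thesis using r(4)[of "r l" n] strict_mono_less_eq[OF mono] by simp
  qed
  then show ?thesis by (rule that[OF mono r(1) r(2)])
qed

lemma half_powers_sums: "(\<lambda>k. a / 2 ^ k) sums (2 * a)" for a :: real
proof -
  have "a / 2 ^ k = a * (1 / 2) ^ k" for k by (simp add: power_one_over)
  then show ?thesis
    using sums_mult[OF geometric_sums[of "1 / 2 :: real"], of a] by (simp add: mult.commute)
qed

text \<open>A vector \<open>u = (x, 0)\<close> supported on the range of \<open>j\<close> is tested against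
  \<open>(KP_map y, y)\<close>, where \<open>y\<close> carries the coefficients of \<open>x\<close> to the range of \<open>i\<close>.\<close>

lemma bounded_below_of_almost_diagonal:
  fixes S :: "'k::real_or_complex seq_pair \<Rightarrow> 'k seq_pair"
  assumes S: "S \<in> Z2_operators" and ij: "strict_mono i" "strict_mono j" and d: "0 < \<delta>"
    and diag: "\<And>m. \<delta> \<le> norm (fst (S (unit_fst (j m))) (i m))"
    and off: "\<And>m k. m \<noteq> k \<Longrightarrow> norm (fst (S (unit_fst (j k))) (i m)) \<le> \<delta> / 16 / 2 ^ m / 2 ^ k"
    and low: "\<And>m k. norm (snd (S (unit_fst (j k))) (i m)) \<le> \<delta> / 16 / 2 ^ m / 2 ^ k"
    and u: "u \<in> supported_subspace (range j)"
  shows "\<delta> / 4 * Z2_qnorm u \<le> Z2_qnorm (S u)"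
proof -
  obtain C where C: "qnorm_bound S C" using Z2_operatorsD(5)[OF S] by blast
  define x where "x = fst u"
  have x: "u = (x, 0)" "x \<in> ell2" "\<And>n. n \<notin> range j \<Longrightarrow> x n = 0" and qu: "Z2_qnorm u = ell2_norm x"
    using u supported_subspace_Z2[OF u] by (auto simp: x_def supported_subspace_def)
  define R c X Y s t where "R = ell2_norm x" and "c k = x (j k)" and "X = fst (S u)" and "Y = snd (S u)"
    and "s m k = fst (S (unit_fst (j k))) (i m)" and "t m k = snd (S (unit_fst (j k))) (i m)" for k m
  have R0: "0 \<le> R" and cR: "norm (c k) \<le> R" for k
    using ell2_norm_nonneg[OF x(2)] ell2_norm_coord[OF x(2)] by (auto simp: R_def c_def)
  have Xs: "(\<lambda>k. c k * s m k) sums X (i m)" and Ys: "(\<lambda>k. c k * t m k) sums Y (i m)" for m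
  proof -
    have "(\<lambda>k. x k * fst (S (unit_fst k)) (i m)) sums X (i m)" "(\<lambda>k. x k * snd (S (unit_fst k)) (i m)) sums Y (i m)"
      using operator_row_sums[OF S x(2)] by (simp_all add: X_def Y_def x(1))
    then show "(\<lambda>k. c k * s m k) sums X (i m)" "(\<lambda>k. c k * t m k) sums Y (i m)"
      unfolding c_def s_def t_def
      using sums_mono_reindex[OF ij(2), of "\<lambda>k. x k * fst (S (unit_fst k)) (i m)"]
        sums_mono_reindex[OF ij(2), of "\<lambda>k. x k * snd (S (unit_fst k)) (i m)"] x(3) by auto
  qed
  \<comment> \<open>The total error \<open>8 * R\<^sup>2 * \<epsilon>\<close> is then half of the
    lower bound \<open>\<delta> * R\<^sup>2\<close> for the main term.\<close>
  define \<epsilon> where "\<epsilon> = \<delta> / 16"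
  have e0: "0 < \<epsilon>" using d by (simp add: \<epsilon>_def)
  have Xb: "norm (X (i m) - c m * s m m) \<le> 2 * (R * \<epsilon> / 2 ^ m)" for m
  proof (rule norm_sums_le)
    have "(\<lambda>k. c k * s m k - (if k = m then c k * s m k else 0)) sums (X (i m) - c m * s m m)"
      by (intro sums_diff Xs sums_single)
    then show "(\<lambda>k. if k = m then 0 else c k * s m k) sums (X (i m) - c m * s m m)"
      by (rule sums_cong[THEN iffD1, rotated]) auto
    show "(\<lambda>k. R * \<epsilon> / 2 ^ m / 2 ^ k) sums (2 * (R * \<epsilon> / 2 ^ m))" by (rule half_powers_sums)
    show "norm (if k = m then 0 else c k * s m k) \<le> R * \<epsilon> / 2 ^ m / 2 ^ k" for k
      using mult_mono[OF cR[of k] off[of m k] R0] R0 e0 by (auto simp: norm_mult \<epsilon>_def s_def)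
  qed
  have Yb: "norm (Y (i m)) \<le> 2 * (R * \<epsilon> / 2 ^ m)" for m
  proof (rule norm_sums_le[OF Ys half_powers_sums])
    show "norm (c k * t m k) \<le> R * \<epsilon> / 2 ^ m / 2 ^ k" for k
      using mult_mono[OF cR[of k] low[of k m] R0] by (auto simp: norm_mult \<epsilon>_def t_def)
  qed
  have "\<forall>m. \<exists>w. norm w = 1 \<and> s m m * conj w = of_real (norm (s m m))"
    by (meson exists_phase)
  then obtain \<theta> where th: "\<And>m. norm (\<theta> m) = 1" "\<And>m. s m m * conj (\<theta> m) = of_real (norm (s m m))"
    by metis
  \<comment> \<open>The phases make the main terms \<open>c m * s m m * conj (y (i m))\<close>
    nonnegative.\<close>
  define y where "y n = (if n \<in> range i then \<theta> (inv i n) * c (inv i n) else 0)" for n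
  have inj: "inj i" using ij(1) by (rule strict_mono_imp_inj_on)
  have yi: "y (i m) = \<theta> m * c m" and y0: "n \<notin> range i \<Longrightarrow> y n = 0" for m n
    using inj by (simp_all add: y_def)
  have cs: "(\<lambda>k. (norm (c k))\<^sup>2) sums R\<^sup>2"
    using sums_mono_reindex[OF ij(2), of "\<lambda>n. (norm (x n))\<^sup>2" "R\<^sup>2"] x(3) ell2_norm_sq[OF x(2)]
    by (simp add: c_def R_def)
  then have "(\<lambda>n. (norm (y n))\<^sup>2) sums R\<^sup>2"
    using sums_mono_reindex[OF ij(1), of "\<lambda>n. (norm (y n))\<^sup>2" "R\<^sup>2"] y0 by (simp add: yi norm_mult th)
  then have y: "y \<in> ell2" "ell2_norm y = R" using R0 by (auto simp: ell2_def ell2_norm_def sums_iff)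
  define v where "v = (KP_map y, y)"
  have v: "v \<in> Z2" "Z2_qnorm v = R" using Z2_KP_map_embed[OF y(1)] y(2) by (auto simp: v_def)
  have Su: "S u \<in> Z2" by (rule Z2_operatorsD(1)[OF S supported_subspace_Z2(2)[OF u]])
  define F where "F m = X (i m) * conj (y (i m)) - Y (i m) * conj (KP_map y (i m))" for m
  have "(\<lambda>n. X n * conj (y n) - Y n * conj (KP_map y n)) sums Z2_form (S u) v"
    using Z2_form_sums[OF Su v(1)] by (simp add: X_def Y_def v_def)
  \<comment> \<open>Off the range of \<open>i\<close> both \<open>y\<close> and
    \<open>KP_map y\<close> vanish, so the form is a series over that range.\<close>
  then have Fs: "F sums Z2_form (S u) v"
    unfolding F_def
    using sums_mono_reindex[OF ij(1), of "\<lambda>n. X n * conj (y n) - Y n * conj (KP_map y n)"] y0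
    by (simp add: KP_map_def)
  define G where "G m = (norm (c m))\<^sup>2 * norm (s m m)" for m
  have "norm (G m) \<le> 2 * C * (norm (c m))\<^sup>2" for m
    using operator_entry_bound(1)[OF S C, of "j m" "i m"] 
    using mult_left_mono[of "norm (s m m)" "2 * C" "(norm (c m))\<^sup>2"] by (simp add: G_def s_def mult.commute)
  then have "summable G"
    using summable_comparison_test'[OF sums_summable[OF sums_mult[OF cs, of "2 * C"]], of 0 G] by auto
  then have Gs: "G sums suminf G" by (rule summable_sums)
  have Gge: "\<delta> * R\<^sup>2 \<le> suminf G"
  proof (rule sums_le[OF _ sums_mult[OF cs] Gs])
    show "\<delta> * (norm (c m))\<^sup>2 \<le> G m" for m
      using mult_right_mono[OF diag[of m], of "(norm (c m))\<^sup>2"] by (simp add: G_def s_def mult.commute)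
  qed
  have FG: "norm (F m - of_real (G m)) \<le> 4 * R\<^sup>2 * \<epsilon> / 2 ^ m" for m
  proof -
    have "c m * s m m * conj (y (i m)) = (s m m * conj (\<theta> m)) * (c m * conj (c m))"
      by (simp only: yi conj_mult mult_ac)
    also have "\<dots> = of_real (G m)"
      unfolding th(2) mult_conj of_real_def[symmetric] G_def of_real_mult by (rule mult.commute)
    finally have "F m - of_real (G m) = (X (i m) - c m * s m m) * conj (y (i m)) - Y (i m) * conj (KP_map y (i m))"
      by (simp add: F_def left_diff_distrib)
    also have "norm \<dots> \<le> norm (X (i m) - c m * s m m) * norm (y (i m)) + norm (Y (i m)) * norm (KP_map y (i m))"
      using norm_triangle_ineq4[of "(X (i m) - c m * s m m) * conj (y (i m))" "Y (i m) * conj (KP_map y (i m))"]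
      by (simp only: norm_mult norm_conj)
    also have "\<dots> \<le> 2 * (R * \<epsilon> / 2 ^ m) * R + 2 * (R * \<epsilon> / 2 ^ m) * R"
    proof (rule add_mono; rule mult_mono)
      show "norm (y (i m)) \<le> R" using ell2_norm_coord[OF y(1)] y(2) by simp
      show "norm (KP_map y (i m)) \<le> R" using KP_map_coord[OF y(1)] y(2) by simp
    qed (use Xb Yb R0 e0 in auto)
    finally show ?thesis by (simp add: power2_eq_square mult_ac)
  qed
  have "norm (Z2_form (S u) v - of_real (suminf G)) \<le> 2 * (4 * R\<^sup>2 * \<epsilon>)"
    by (rule norm_sums_le[OF sums_diff[OF Fs sums_of_real[OF Gs]] half_powers_sums FG])
  moreover have "norm (of_real (suminf G) :: 'k) - norm (Z2_form (S u) v) \<le> norm (Z2_form (S u) v - of_real (suminf G))"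
    by (metis norm_minus_commute norm_triangle_ineq2)
  moreover have "\<delta> * R\<^sup>2 \<le> norm (of_real (suminf G) :: 'k)" using Gge by simp
  moreover have "norm (Z2_form (S u) v) \<le> 2 * Z2_qnorm (S u) * R"
    using Z2_form_bound[OF Su v(1)] v(2) by simp
  \<comment> \<open>The form is at least \<open>\<delta> / 2 * R\<^sup>2\<close> after subtraction
    of the error, and at most \<open>2 * R\<close> times the quasi-norm of
    \<open>S u\<close>.\<close>
  ultimately have "R * (\<delta> / 4 * R) \<le> R * Z2_qnorm (S u)"
    by (simp add: \<epsilon>_def power2_eq_square algebra_simps)
  then show ?thesis
    using R0 Z2_qnorm_nonneg[OF Su] by (cases "R = 0") (auto simp: qu R_def[symmetric])
qed

text \<open>If the entries of the first component stayed above \<delta> along infinitely many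
  indices, the matrix of \<open>S\<close> would be almost diagonal along a sparse subsequence, and
  \<open>S\<close> would be bounded below on a copy of \<open>ell2\<close>. The second claim follows
  because the difference of the two diagonal entries tends to 0.\<close>

lemma strictly_singular_entries_tendsto_0:
  fixes S :: "'k::real_or_complex seq_pair \<Rightarrow> 'k seq_pair"
  assumes S: "S \<in> Z2_strictly_singular" and ij: "strict_mono i" "strict_mono j"
  shows "(\<lambda>k. fst (S (unit_fst (j k))) (i k)) \<longlonglongrightarrow> 0"
    "(\<lambda>k. snd (S (unit_snd (j k))) (i k)) \<longlonglongrightarrow> 0"
proof -
  have So: "S \<in> Z2_operators" using S by (simp add: Z2_strictly_singular_def)
  have inj: "inj i" "inj j" using ij by (auto intro: strict_mono_imp_inj_on)
  define s t where "s a b = fst (S (unit_fst (j b))) (i a)" and "t a b = snd (S (unit_fst (j b))) (i a)" for a b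
  show 1: "(\<lambda>k. fst (S (unit_fst (j k))) (i k)) \<longlonglongrightarrow> 0"
  proof (rule ccontr)
    assume "\<not> ?thesis"
    then obtain \<delta> where d: "0 < \<delta>" "infinite {k. \<delta> \<le> norm (s k k)}"
      unfolding s_def by (rule not_tendsto_0_infinite)
    \<comment> \<open>At the larger index \<open>q\<close>, the denominator \<open>4 ^ q\<close> is
      at least \<open>2 ^ l * 2 ^ q\<close> for every \<open>l \<le> q\<close>, so one threshold
      serves both orders of row and column.\<close>
    let ?e = "\<lambda>q. \<delta> / 16 / 4 ^ q"
    define P where "P q a b \<longleftrightarrow> norm (s a b) < ?e q \<and> norm (s b a) < ?e q \<and> norm (t a b) < ?e q \<and> norm (t b a) < ?e q" for q a b
    define Q where "Q q b \<longleftrightarrow> norm (t b b) < ?e q" for q b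
    have ev: "eventually (\<lambda>b. norm (f b) < ?e q) sequentially" if "f \<longlonglongrightarrow> 0" for f :: "nat \<Rightarrow> 'k" and q
      using order_tendstoD(2)[OF tendsto_norm_zero[OF that], of "?e q"] d(1) by simp
    have sub: "(\<lambda>b. f (g b)) \<longlonglongrightarrow> 0" if "f \<longlonglongrightarrow> 0" "strict_mono g" for f :: "nat \<Rightarrow> 'k" and g
      using LIMSEQ_subseq_LIMSEQ[OF that] by (simp add: o_def)
    have col: "S (unit_fst (j a)) \<in> Z2" for a by (rule Z2_operatorsD(1)[OF So unit_fst_Z2(1)])
    \<comment> \<open>For a fixed earlier index \<open>a\<close>, the entries along its row and
      along its column tend to 0, in both components.\<close>
    have "eventually (P q a) sequentially" for q a
      using ev[OF sub[OF operator_row_tendsto_0(1)[OF So] ij(2)], of "i a" q]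
        ev[OF sub[OF Z2_coord_tendsto_0(2)[OF col] ij(1)], of a q]
        ev[OF sub[OF operator_row_tendsto_0(2)[OF So] ij(2)], of "i a" q]
        ev[OF sub[OF Z2_coord_tendsto_0(1)[OF col] ij(1)], of a q]
      unfolding P_def s_def t_def by (intro eventually_conj)
    \<comment> \<open>On the diagonal of \<open>t\<close> row and column move together, which is the
      case of \<open>lower_entries_tendsto_0\<close>.\<close>
    moreover have "eventually (Q q) sequentially" for q
      using ev[OF lower_entries_tendsto_0[OF So inj], of q] unfolding Q_def t_def .
    ultimately obtain r where r: "strict_mono r" "\<And>q. r q \<in> {k. \<delta> \<le> norm (s k k)}" "\<And>q. Q q (r q)"
      "\<And>l q. l < q \<Longrightarrow> P q (r l) (r q)"
      using sparse_subsequence[OF d(2), of P Q] by blast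
    note rQ = r(3)[unfolded Q_def] and rP = r(4)[unfolded P_def]
    have pw: "?e q \<le> \<delta> / 16 / 2 ^ l / 2 ^ q" "?e q \<le> \<delta> / 16 / 2 ^ q / 2 ^ l" if "l \<le> q" for l q
    proof -
      have "(2::real) ^ l * 2 ^ q \<le> 2 ^ q * 2 ^ q" using that by (intro mult_right_mono power_increasing) auto
      also have "\<dots> = 4 ^ q" by (simp flip: power_mult_distrib)
      finally have "\<delta> / 16 / 4 ^ q \<le> \<delta> / 16 / (2 ^ l * 2 ^ q)"
        using d(1) by (intro divide_left_mono) auto
      then show "?e q \<le> \<delta> / 16 / 2 ^ l / 2 ^ q" "?e q \<le> \<delta> / 16 / 2 ^ q / 2 ^ l"
        by (simp_all add: mult_ac)
    qed
    have off: "norm (s (r m) (r k)) \<le> \<delta> / 16 / 2 ^ m / 2 ^ k" if "m \<noteq> k" for m k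
      using that rP[of m k] rP[of k m] pw(1)[of m k] pw(2)[of k m] by (cases "m < k") auto
    have low: "norm (t (r m) (r k)) \<le> \<delta> / 16 / 2 ^ m / 2 ^ k" for m k
      using rP[of m k] rP[of k m] pw(1)[of m k] pw(2)[of k m] rQ[of m] less_linear[of m k]
      by auto
    have mono: "strict_mono (\<lambda>k. i (r k))" "strict_mono (\<lambda>k. j (r k))"
      using strict_mono_o[OF ij(1) r(1)] strict_mono_o[OF ij(2) r(1)] by (auto simp: o_def)
    let ?M = "supported_subspace (range (\<lambda>k. j (r k))) :: 'k seq_pair set"
    have "\<forall>u\<in>?M. \<delta> / 4 * Z2_qnorm u \<le> Z2_qnorm (S u)"
      using bounded_below_of_almost_diagonal[OF So mono d(1)] r(2) off low
      unfolding s_def t_def by blast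
    moreover have "infinite_dimensional ?M"
      by (intro infinite_dimensional_supported_subspace range_inj_infinite strict_mono_imp_inj_on mono)
    moreover have "0 < \<delta> / 4" using d(1) by simp
    ultimately show False
      using S closed_supported_subspace unfolding Z2_strictly_singular_def by blast
  qed
  show "(\<lambda>k. snd (S (unit_snd (j k))) (i k)) \<longlonglongrightarrow> 0"
    using tendsto_diff[OF 1 diagonal_entries_diff_tendsto_0[OF So inj]] by simp
qed

subsection \<open>Symplectic Walsh--Hadamard operators\<close>

lemma sums_permute:
  fixes f :: "nat \<Rightarrow> 'a::banach"
  assumes "summable (\<lambda>n. norm (f n))" "f sums s" "bij p"
  shows "(\<lambda>n. f (p n)) sums s"
  using norm_summable_imp_has_sum[OF assms(1,2)] has_sum_reindex_bij_betw[of p UNIV UNIV f s] assms(3)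
  by (auto intro: has_sum_imp_sums)

definition signed_permutation ::
  "(nat \<Rightarrow> real) \<Rightarrow> (nat \<Rightarrow> nat) \<Rightarrow> 'k::real_or_complex seq_pair \<Rightarrow> 'k seq_pair" where
  "signed_permutation s p u = ((\<lambda>n. of_real (s n) * fst u (p n)), (\<lambda>n. of_real (s n) * snd u (p n)))"

lemma signed_permutation_simps [simp]:
  "fst (signed_permutation s p u) n = of_real (s n) * fst u (p n)"
  "snd (signed_permutation s p u) n = of_real (s n) * snd u (p n)"
  by (simp_all add: signed_permutation_def)

lemma ell2_signed_permutation:
  fixes x :: "nat \<Rightarrow> 'k::real_or_complex"
  assumes x: "x \<in> ell2" and s: "\<And>n. \<bar>s n\<bar> = 1" and p: "bij p"
  shows "(\<lambda>n. of_real (s n) * x (p n)) \<in> ell2" "ell2_norm (\<lambda>n. of_real (s n) * x (p n)) = ell2_norm x"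
proof -
  have "(\<lambda>n. (norm (x (p n)))\<^sup>2) sums (ell2_norm x)\<^sup>2"
    using sums_permute[OF _ ell2_norm_sq[OF x] p] x by (simp add: ell2_def)
  then show "(\<lambda>n. of_real (s n) * x (p n)) \<in> ell2" "ell2_norm (\<lambda>n. of_real (s n) * x (p n)) = ell2_norm x"
    using ell2_norm_nonneg[OF x] by (auto simp: ell2_def ell2_norm_def[of "\<lambda>n. of_real (s n) * x (p n)"] norm_mult s sums_iff)
qed

text \<open>The logarithmic factor in \<open>KP_map\<close> depends only on moduli and on the norm,
  so \<open>KP_map\<close> commutes with signed permutations.\<close>

lemma Z2_signed_permutation:
  assumes u: "u \<in> Z2" and s: "\<And>n. \<bar>s n\<bar> = 1" and p: "bij p"
  shows "signed_permutation s p u \<in> Z2" "Z2_qnorm (signed_permutation s p u) = Z2_qnorm u"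
proof -
  have e: "snd u \<in> ell2" "fst u - KP_map (snd u) \<in> ell2" using u by (auto simp: Z2_iff)
  note i = ell2_signed_permutation[OF e(1) s p] and i' = ell2_signed_permutation[OF e(2) s p]
  have s0: "s n \<noteq> 0" for n using s[of n] by auto
  have "KP_map (\<lambda>n. of_real (s n) * snd u (p n)) n = of_real (s n) * KP_map (snd u) (p n)" for n
    unfolding KP_map_def i(2) by (simp add: norm_mult s s0)
  then have "fst (signed_permutation s p u) - KP_map (snd (signed_permutation s p u))
    = (\<lambda>n. of_real (s n) * (fst u - KP_map (snd u)) (p n))"
    by (simp add: signed_permutation_def fun_eq_iff right_diff_distrib)
  then show "signed_permutation s p u \<in> Z2" "Z2_qnorm (signed_permutation s p u) = Z2_qnorm u"
    using i i' by (simp_all add: Z2_iff Z2_qnorm_def) (simp_all add: signed_permutation_def)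
qed

text \<open>Absolute convergence allows the series to be rearranged by \<open>p\<close>. As
  \<open>p\<close> is an involution and \<open>s\<close> is constant on its orbits, this moves the
  operator to the other argument.\<close>

lemma Z2_form_signed_permutation:
  fixes u v :: "'k::real_or_complex seq_pair"
  assumes u: "u \<in> Z2" and v: "v \<in> Z2" and s: "\<And>n. \<bar>s n\<bar> = 1" and p: "bij p" "\<And>n. p (p n) = n"
    and sp: "\<And>n. s (p n) = s n"
  shows "Z2_form (signed_permutation s p u) v = Z2_form u (signed_permutation s p v)"
proof -
  define w where "w = signed_permutation s p u"
  have w: "w \<in> Z2" unfolding w_def by (rule Z2_signed_permutation(1)[OF u s p(1)])
  have cs: "conj (of_real (s n) * a) = of_real (s n) * conj (a :: 'k)" for n a
    by (simp only: conj_mult conj_of_real)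
  have "(\<lambda>n. fst w (p n) * conj (snd v (p n)) - snd w (p n) * conj (fst v (p n))) sums Z2_form w v"
    by (rule sums_permute[OF Z2_form_summable_bound(1)[OF w v] Z2_form_sums[OF w v] p(1)])
  moreover have "fst w (p n) * conj (snd v (p n)) - snd w (p n) * conj (fst v (p n)) =
     fst u n * conj (snd (signed_permutation s p v) n) - snd u n * conj (fst (signed_permutation s p v) n)" for n
    unfolding w_def signed_permutation_simps cs p(2) sp by (simp add: mult_ac)
  ultimately show ?thesis by (simp add: Z2_form_def[of u] w_def sums_iff)
qed

text \<open>On each pair of coordinates \<open>n\<close> and \<open>flip_bit l n\<close> this is the
  matrix with rows \<open>(1, 1)\<close> and \<open>(1, -1)\<close>, divided by
  \<open>sqrt 2\<close>. Written as a sum of two signed permutations, it inherits their boundedness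
  and symmetry.\<close>

definition walsh :: "nat \<Rightarrow> 'k::real_or_complex seq_pair \<Rightarrow> 'k seq_pair" where
  "walsh l u = (if u \<in> Z2 then seq_scale (of_real (1 / sqrt 2))
     (signed_permutation (\<lambda>n. if bit n l then - 1 else 1) id u + signed_permutation (\<lambda>_. 1) (flip_bit l) u) else 0)"

lemma flip_bit_flip_bit: "flip_bit l (flip_bit l n) = (n :: nat)"
  by (rule bit_eqI) (auto simp: bit_flip_bit_iff)

lemma bij_flip_bit: "bij (flip_bit l :: nat \<Rightarrow> nat)"
  by (rule o_bij[of "flip_bit l"]) (auto simp: flip_bit_flip_bit)

lemma walsh_coord:
  assumes "u \<in> Z2"
  shows "fst (walsh l u) n = of_real (1 / sqrt 2) * (of_real (if bit n l then - 1 else 1) * fst u n + fst u (flip_bit l n))"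
    "snd (walsh l u) n = of_real (1 / sqrt 2) * (of_real (if bit n l then - 1 else 1) * snd u n + snd u (flip_bit l n))"
  using assms by (simp_all add: walsh_def)

lemma walsh_parts_Z2:
  assumes "u \<in> Z2"
  shows "signed_permutation (\<lambda>n. if bit n l then - 1 else 1) id u \<in> Z2"
    "Z2_qnorm (signed_permutation (\<lambda>n. if bit n l then - 1 else 1) id u) = Z2_qnorm u"
    "signed_permutation (\<lambda>_. 1) (flip_bit l) u \<in> Z2"
    "Z2_qnorm (signed_permutation (\<lambda>_. 1) (flip_bit l) u) = Z2_qnorm u"
  using Z2_signed_permutation[OF assms, of "\<lambda>n. if bit n l then - 1 else 1" id]
    Z2_signed_permutation[OF assms, of "\<lambda>_. 1" "flip_bit l"] bij_flip_bit by auto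

lemma walsh_operator: "(walsh l :: 'k::real_or_complex seq_pair \<Rightarrow> 'k seq_pair) \<in> Z2_operators"
  unfolding Z2_operators_def
proof (intro CollectI conjI ballI allI impI exI)
  fix u v :: "'k seq_pair" and c :: 'k assume u: "u \<in> Z2"
  note p = walsh_parts_Z2[OF u, of l]
  show "walsh l u \<in> Z2"
    using u p by (simp add: walsh_def Z2_scale Z2_add)
  have "walsh l (seq_scale c u) = seq_scale c (walsh l u)"
    by (simp add: prod_eq_iff fun_eq_iff walsh_coord u Z2_scale distrib_left mult.left_commute)
  then show "walsh l (seq_scale c u) = seq_scale c (walsh l u)" .
  have "Z2_qnorm (walsh l u) = 1 / sqrt 2 * Z2_qnorm (signed_permutation (\<lambda>n. if bit n l then - 1 else 1) id u
      + signed_permutation (\<lambda>_. 1) (flip_bit l) u)"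
    using u p by (simp add: walsh_def Z2_qnorm_scale Z2_add norm_divide)
  also have "\<dots> \<le> 1 / sqrt 2 * (7 * (Z2_qnorm u + Z2_qnorm u))"
    using Z2_add(2)[OF p(1,3)] unfolding p by (intro mult_left_mono) auto
  finally show "Z2_qnorm (walsh l u) \<le> 14 / sqrt 2 * Z2_qnorm u" by simp
  assume v: "v \<in> Z2"
  show "walsh l (u + v) = walsh l u + walsh l v"
    by (simp add: prod_eq_iff fun_eq_iff walsh_coord u v Z2_add distrib_left add_ac)
qed (simp add: walsh_def)

lemma walsh_symmetric:
  assumes u: "u \<in> Z2" and v: "v \<in> Z2"
  shows "Z2_form (walsh l u) v = Z2_form u (walsh l v)"
proof -
  note p = walsh_parts_Z2[OF u, of l] and p' = walsh_parts_Z2[OF v, of l]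
  have "Z2_form (signed_permutation (\<lambda>n. if bit n l then - 1 else 1) id u) v
    = Z2_form u (signed_permutation (\<lambda>n. if bit n l then - 1 else 1) id v)"
    by (rule Z2_form_signed_permutation[OF u v]) auto
  moreover have "Z2_form (signed_permutation (\<lambda>_. 1) (flip_bit l) u) v
    = Z2_form u (signed_permutation (\<lambda>_. 1) (flip_bit l) v)"
    by (rule Z2_form_signed_permutation[OF u v]) (auto simp: bij_flip_bit flip_bit_flip_bit)
  ultimately show ?thesis
    unfolding walsh_def if_P[OF u] if_P[OF v]
    by (simp only: Z2_form_scale Z2_form_add Z2_add p p' u v conj_of_real)
qed

definition Z2_identity :: "'k::real_or_complex seq_pair \<Rightarrow> 'k seq_pair" where
  "Z2_identity u = (if u \<in> Z2 then u else 0)"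

lemma Z2_identity_operator: "Z2_identity \<in> Z2_operators"
  unfolding Z2_operators_def
  by (auto simp: Z2_identity_def Z2_add Z2_scale intro!: exI[of _ 1])

text \<open>The signs at \<open>n\<close> and \<open>flip_bit l n\<close> are opposite, so the mixed
  terms of the square cancel; the other two, each with factor 1/2, add up to the identity.\<close>

lemma walsh_walsh: "walsh l \<circ> walsh l = Z2_identity"
proof
  fix u :: "'a seq_pair"
  show "(walsh l \<circ> walsh l) u = Z2_identity u"
  proof (cases "u \<in> Z2")
    case True
    note w = Z2_operatorsD(1)[OF walsh_operator True, of l]
    define c \<sigma> where "c = (of_real (1 / sqrt 2) :: 'a)" and "\<sigma> n = (of_real (if bit n l then - 1 else 1) :: 'a)" for n :: nat
    have c2: "c * c = 1 / 2"
    proof -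
      have "c * c = of_real (1 / sqrt 2 * (1 / sqrt 2))" by (simp only: c_def of_real_mult)
      also have "1 / sqrt 2 * (1 / sqrt 2) = 1 / (2::real)" by simp
      finally show ?thesis by simp
    qed
    have s: "\<sigma> n * \<sigma> n = 1" "\<sigma> (flip_bit l n) = - \<sigma> n" for n
      by (simp_all add: \<sigma>_def bit_flip_bit_iff)
    have h: "c * (\<sigma> n * (c * (\<sigma> n * x + y)) + c * (- \<sigma> n * y + x)) = x" for x y n
    proof -
      have "c * (\<sigma> n * (c * (\<sigma> n * x + y)) + c * (- \<sigma> n * y + x)) = (c * c) * ((\<sigma> n * \<sigma> n) * x + x)"
        by (simp add: algebra_simps)
      then show ?thesis by (simp add: c2 s)
    qed
    have "fst (walsh l (walsh l u)) n = fst u n" "snd (walsh l (walsh l u)) n = snd u n" for n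
      unfolding walsh_coord[OF w] walsh_coord[OF True] flip_bit_flip_bit
      by (fold c_def \<sigma>_def, simp_all only: s(2) h)
    then show ?thesis by (simp add: Z2_identity_def True prod_eq_iff fun_eq_iff)
  next
    case False
    then show ?thesis
      using Z2_operator_zero[OF walsh_operator, of l] by (simp add: Z2_identity_def walsh_def)
  qed
qed

lemma Z2_operators_comp:
  assumes T: "T \<in> Z2_operators" and R: "R \<in> Z2_operators"
  shows "T \<circ> R \<in> Z2_operators"
proof -
  obtain C D where C: "qnorm_bound T C" and D: "qnorm_bound R D"
    using Z2_operatorsD(5)[OF T] Z2_operatorsD(5)[OF R] by blast
  have "Z2_qnorm (T (R u)) \<le> C * D * Z2_qnorm u" if "u \<in> Z2" for u
  proof -
    have "Z2_qnorm (T (R u)) \<le> C * Z2_qnorm (R u)"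
      using C Z2_operatorsD(1)[OF R that] unfolding qnorm_bound_def by blast
    also have "\<dots> \<le> C * (D * Z2_qnorm u)"
      using D that qnorm_bound_nonneg[OF T C] unfolding qnorm_bound_def by (intro mult_left_mono) auto
    finally show ?thesis by (simp add: mult.assoc)
  qed
  then show ?thesis
    unfolding Z2_operators_def using T R
    by (auto simp: Z2_operatorsD(1,3,4)[OF T] Z2_operatorsD(1-4)[OF R] Z2_operator_zero[OF T] intro!: exI[of _ "C * D"])
qed

lemma Z2_operators_diff:
  assumes T: "T \<in> Z2_operators" and R: "R \<in> Z2_operators"
  shows "T - R \<in> Z2_operators"
proof -
  obtain C D where C: "qnorm_bound T C" and D: "qnorm_bound R D"
    using Z2_operatorsD(5)[OF T] Z2_operatorsD(5)[OF R] by blast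
  have "Z2_qnorm (T u - R u) \<le> 7 * (C + D) * Z2_qnorm u" if "u \<in> Z2" for u
    using Z2_diff(2)[OF Z2_operatorsD(1)[OF T that] Z2_operatorsD(1)[OF R that]] C D that
    unfolding qnorm_bound_def by (fastforce simp: algebra_simps)
  then show ?thesis
    unfolding Z2_operators_def
    by (auto simp: Z2_operatorsD[OF T] Z2_operatorsD[OF R] Z2_diff(1) seq_pair.scale_right_diff_distrib
        simp del: split_paired_All intro!: exI[of _ "7 * (C + D)"])
qed

section \<open>Hadamard matrices on blocks of coordinates\<close>

text \<open>The tensor product of \<open>m\<close> normalised two by two Hadamard matrices, acting
  on the lowest \<open>m\<close> bits of the index and thus on each block of \<open>2 ^ m\<close>
  consecutive coordinates. The factors are self-adjoint involutions, which is what fixes the norm of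
  its image in a B*-algebra.\<close>

primrec hadamard :: "nat \<Rightarrow> 'k::real_or_complex seq_pair \<Rightarrow> 'k seq_pair" where
  "hadamard 0 = Z2_identity"
| "hadamard (Suc m) = walsh m \<circ> hadamard m"

lemma hadamard_operator: "hadamard m \<in> Z2_operators"
  by (induction m) (simp_all add: Z2_identity_operator Z2_operators_comp walsh_operator del: o_apply)

text \<open>A Walsh function: -1 to the number of common ones among the lowest \<open>m\<close>
  binary digits of \<open>i\<close> and \<open>j\<close>.\<close>

definition hadamard_sign :: "nat \<Rightarrow> nat \<Rightarrow> nat \<Rightarrow> real" where
  "hadamard_sign m i j = (\<Prod>l<m. if bit i l \<and> bit j l then - 1 else 1)"

lemma hadamard_sign_abs: "\<bar>hadamard_sign m i j\<bar> = 1"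
  unfolding hadamard_sign_def abs_prod by (rule prod.neutral) auto

lemma hadamard_sign_commute: "hadamard_sign m i j = hadamard_sign m j i"
  unfolding hadamard_sign_def by (simp add: conj_commute)

text \<open>Equal values of \<open>drop_bit m\<close> mean the same block of length
  \<open>2 ^ m\<close>.\<close>

definition hadamard_entry :: "nat \<Rightarrow> nat \<Rightarrow> nat \<Rightarrow> real" where
  "hadamard_entry m i j = (if drop_bit m i = drop_bit m j then hadamard_sign m i j / sqrt (2 ^ m) else 0)"

lemma drop_bit_eq_iff_bits: "drop_bit m i = drop_bit m j \<longleftrightarrow> (\<forall>l\<ge>m. bit i l = bit (j::nat) l)"
proof
  assume *: "drop_bit m i = drop_bit m j"
  show "\<forall>l\<ge>m. bit i l = bit j l"
  proof (intro allI impI)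
    fix l assume "m \<le> l"
    then have "bit (drop_bit m i) (l - m) = bit i l" "bit (drop_bit m j) (l - m) = bit j l"
      by (simp_all add: bit_drop_bit_eq)
    with * show "bit i l = bit j l" by simp
  qed
next
  assume "\<forall>l\<ge>m. bit i l = bit j l"
  then show "drop_bit m i = drop_bit m j"
    by (intro bit_eqI) (simp add: bit_drop_bit_eq)
qed

text \<open>If \<open>i\<close> and \<open>j\<close> agree above bit \<open>m\<close>, exactly one
  of \<open>i\<close> and \<open>flip_bit m i\<close> lies in the smaller block of \<open>j\<close>,
  so one summand survives. It carries an extra sign -1 precisely when both indices have bit
  \<open>m\<close>.\<close>

lemma hadamard_entry_Suc:
  "hadamard_entry (Suc m) i j
    = 1 / sqrt 2 * ((if bit i m then - 1 else 1) * hadamard_entry m i j + hadamard_entry m (flip_bit m i) j)"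
proof -
  have sg: "hadamard_sign (Suc m) i j = (if bit i m \<and> bit j m then - 1 else 1) * hadamard_sign m i j"
    by (simp add: hadamard_sign_def)
  have fl: "hadamard_sign m (flip_bit m i) j = hadamard_sign m i j"
    unfolding hadamard_sign_def by (rule prod.cong) (auto simp: bit_flip_bit_iff)
  have d0: "drop_bit m i = drop_bit m j \<longleftrightarrow> drop_bit (Suc m) i = drop_bit (Suc m) j \<and> bit i m = bit j m" for i :: nat
    unfolding drop_bit_eq_iff_bits by (metis Suc_leD Suc_leI le_neq_implies_less order_refl)
  have d1: "drop_bit m (flip_bit m i) = drop_bit m j \<longleftrightarrow> drop_bit (Suc m) i = drop_bit (Suc m) j \<and> bit i m \<noteq> bit j m"
  proof -
    have "drop_bit (Suc m) (flip_bit m i) = drop_bit (Suc m) i"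
      unfolding drop_bit_eq_iff_bits by (auto simp: bit_flip_bit_iff)
    then show ?thesis
      unfolding d0[of "flip_bit m i"] by (auto simp: bit_flip_bit_iff)
  qed
  show ?thesis
    unfolding hadamard_entry_def d0[of i] d1 sg fl by (auto simp: real_sqrt_mult)
qed

lemma hadamard_coord:
  "fst (hadamard m (unit_fst j)) i = of_real (hadamard_entry m i j)"
  "snd (hadamard m (unit_snd j)) i = of_real (hadamard_entry m i j)"
proof -
  have "fst (hadamard m (unit_fst j)) i = of_real (hadamard_entry m i j) \<and>
    snd (hadamard m (unit_snd j)) i = of_real (hadamard_entry m i j)"
  proof (induction m arbitrary: i)
    case 0
    show ?case
      by (simp add: Z2_identity_def unit_fst_Z2 unit_snd_Z2 hadamard_entry_def hadamard_sign_def)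
         (simp add: unit_fst_def unit_snd_def unit_seq_def)
  next
    case (Suc m)
    note in1 = Z2_operatorsD(1)[OF hadamard_operator unit_fst_Z2(1)]
      and in2 = Z2_operatorsD(1)[OF hadamard_operator unit_snd_Z2(1)]
    show ?case
      unfolding hadamard.simps o_apply walsh_coord[OF in1] walsh_coord[OF in2] hadamard_entry_Suc
      using Suc by simp
  qed
  then show "fst (hadamard m (unit_fst j)) i = of_real (hadamard_entry m i j)"
    "snd (hadamard m (unit_snd j)) i = of_real (hadamard_entry m i j)" by auto
qed

text \<open>\<open>symmetric_sum_bound\<close> is applied to \<open>hadamard m - S\<close> on the
  \<open>k\<close>-th block. The Hadamard part contributes \<open>2 * n\<close>, and the part
  \<open>G k\<close> coming from \<open>S\<close> tends to 0 as the blocks move out. In the limit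
  \<open>2 * n * L \<le> 4 * C * n\<close>.\<close>

lemma hadamard_distance_strictly_singular:
  fixes S :: "'k::real_or_complex seq_pair \<Rightarrow> 'k seq_pair"
  assumes S: "S \<in> Z2_strictly_singular" and C: "qnorm_bound (hadamard m - S) C"
  shows "ln (sqrt (2 ^ m)) \<le> 2 * C"
proof -
  have So: "S \<in> Z2_operators" using S by (simp add: Z2_strictly_singular_def)
  define n :: nat where "n = 2 ^ m"
  define L where "L = ln (sqrt (real n))"
  have n0: "0 < n" and L0: "0 \<le> L" by (simp_all add: n_def L_def)
  define T where "T = hadamard m - S"
  have T: "T \<in> Z2_operators" "qnorm_bound T C"
    using Z2_operators_diff[OF hadamard_operator So] C by (auto simp: T_def)
  let ?\<sigma> = "hadamard_sign m"
  let ?a = "\<lambda>k r. n * k + r"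
  define G where "G k = (\<Sum>r<n. \<Sum>s<n. of_real (?\<sigma> (?a k r) (?a k s) / sqrt (real n)) *
      (fst (S (unit_fst (?a k s))) (?a k r) + snd (S (unit_snd (?a k r))) (?a k s)))" for k
  have bound: "norm (of_real L * (of_nat (2 * n) - G k)) \<le> 4 * C * real n" for k
  proof -
    let ?A = "?a k ` {..<n}"
    have inj: "inj_on (?a k) {..<n}" by simp
    have card: "real n = real (card ?A)" by (simp add: card_image)
    have "norm (of_real L * (\<Sum>i\<in>?A. \<Sum>j\<in>?A. of_real (?\<sigma> i j / sqrt (real n)) *
        (fst (T (unit_fst j)) i + snd (T (unit_snd i)) j))) \<le> 4 * C * real n"
      by (rule symmetric_sum_bound[OF T _ _ card L_def])
         (use n0 hadamard_sign_abs hadamard_sign_commute in auto)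
    also have "(\<Sum>i\<in>?A. \<Sum>j\<in>?A. of_real (?\<sigma> i j / sqrt (real n)) * (fst (T (unit_fst j)) i + snd (T (unit_snd i)) j))
      = (\<Sum>r<n. \<Sum>s<n. of_real (?\<sigma> (?a k r) (?a k s) / sqrt (real n)) *
        (fst (T (unit_fst (?a k s))) (?a k r) + snd (T (unit_snd (?a k r))) (?a k s)))"
      by (simp add: sum.reindex[OF inj])
    \<comment> \<open>The signs square to 1, so each Hadamard entry times the sum of the two
      matching diagonal entries of \<open>hadamard m\<close> is \<open>2 / n\<close>.\<close>
    also have "\<dots> = (\<Sum>r<n. \<Sum>s<n. of_real (2 / real n) - of_real (?\<sigma> (?a k r) (?a k s) / sqrt (real n)) *
      (fst (S (unit_fst (?a k s))) (?a k r) + snd (S (unit_snd (?a k r))) (?a k s)))"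
    proof (intro sum.cong refl)
      fix r s assume "r \<in> {..<n}" "s \<in> {..<n}"
      then have rs: "drop_bit m (?a k r) = k" "drop_bit m (?a k s) = k"
        by (simp_all add: drop_bit_eq_div n_def)
      define \<tau> where "\<tau> = ?\<sigma> (?a k r) (?a k s)"
      have t2: "\<tau> * \<tau> = 1" using hadamard_sign_abs[of m "?a k r" "?a k s"]
        by (simp add: \<tau>_def) (metis abs_mult_self_eq mult_1)
      have en: "hadamard_entry m (?a k r) (?a k s) = \<tau> / sqrt (real n)" "hadamard_entry m (?a k s) (?a k r) = \<tau> / sqrt (real n)"
        using rs hadamard_sign_commute[of m "?a k s" "?a k r"]
        by (simp_all add: hadamard_entry_def \<tau>_def n_def)
      have eq: "h * (h - p + (h - b)) = 2 * (h * h) - h * (p + b)" for h p b :: 'k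
        by (simp add: algebra_simps)
      have "of_real (\<tau> / sqrt (real n)) * of_real (\<tau> / sqrt (real n)) = (of_real (1 / real n) :: 'k)"
        using n0 t2 by (simp only: of_real_mult[symmetric]) simp
      then show "of_real (?\<sigma> (?a k r) (?a k s) / sqrt (real n)) *
        (fst (T (unit_fst (?a k s))) (?a k r) + snd (T (unit_snd (?a k r))) (?a k s)) =
        of_real (2 / real n) - of_real (?\<sigma> (?a k r) (?a k s) / sqrt (real n)) *
        (fst (S (unit_fst (?a k s))) (?a k r) + snd (S (unit_snd (?a k r))) (?a k s))"
        unfolding T_def minus_apply fst_diff snd_diff hadamard_coord en \<tau>_def[symmetric] eq by simp
    qed
    also have "\<dots> = of_nat (2 * n) - G k"
      unfolding G_def sum_subtractf using n0 by simp
    finally show ?thesis .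
  qed
  \<comment> \<open>For fixed offsets inside the block, row and column indices increase strictly
    with \<open>k\<close>, as the limits of entries require.\<close>
  have mono: "strict_mono (\<lambda>k. ?a k r)" for r
    using n0 by (intro strict_monoI) simp
  have term0: "(\<lambda>k. of_real (?\<sigma> (?a k r) (?a k s) / sqrt (real n)) *
      (fst (S (unit_fst (?a k s))) (?a k r) + snd (S (unit_snd (?a k r))) (?a k s))) \<longlonglongrightarrow> 0" for r s
  proof -
    let ?f = "\<lambda>k. fst (S (unit_fst (?a k s))) (?a k r) + snd (S (unit_snd (?a k r))) (?a k s)"
    have "?f \<longlonglongrightarrow> 0 + 0"
      by (intro tendsto_add strictly_singular_entries_tendsto_0[OF S mono mono])
    then have "(\<lambda>k. norm (?f k) * (1 / sqrt (real n))) \<longlonglongrightarrow> 0 * (1 / sqrt (real n))"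
      by (intro tendsto_mult tendsto_const) (simp add: tendsto_norm_zero)
    then have lim: "(\<lambda>k. norm (?f k) * (1 / sqrt (real n))) \<longlonglongrightarrow> 0" by simp
    show ?thesis
      by (rule Lim_null_comparison[OF always_eventually lim])
         (simp add: norm_mult norm_divide hadamard_sign_abs)
  qed
  have "G \<longlonglongrightarrow> (\<Sum>r<n. \<Sum>s<n. 0)"
    unfolding G_def by (intro tendsto_sum term0)
  then have "(\<lambda>k. norm (of_real L * (of_nat (2 * n) - G k))) \<longlonglongrightarrow> norm (of_real L * (of_nat (2 * n) - 0 :: 'k))"
    by (intro tendsto_intros) simp
  then have "norm (of_real L * (of_nat (2 * n) - 0 :: 'k)) \<le> 4 * C * real n"
    by (rule LIMSEQ_le_const2) (use bound in blast)
  then have "norm (of_real L * (of_nat (2 * n) :: 'k)) \<le> 4 * C * real n"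
    unfolding diff_zero .
  moreover have "norm (of_real L * (of_nat (2 * n) :: 'k)) = L * (2 * real n)"
    using L0 by (simp only: norm_mult norm_of_real norm_of_nat)
  ultimately show ?thesis using n0 by (simp add: L_def n_def)
qed

subsection \<open>The quotient algebra\<close>

lemma Z2_form_unit_left:
  "Z2_form (unit_fst i) w = conj (snd w i)" "Z2_form (unit_snd i) w = - conj (fst w i)"
proof -
  have "Z2_form (unit_fst i) w = (\<Sum>n. if n = i then conj (snd w n) else 0)"
    unfolding Z2_form_def by (intro arg_cong[where f = suminf]) (auto simp: unit_fst_def unit_seq_def)
  then show "Z2_form (unit_fst i) w = conj (snd w i)"
    using sums_unique[OF sums_single[of i "\<lambda>n. conj (snd w n)"]] by simp
  have "Z2_form (unit_snd i) w = (\<Sum>n. if n = i then - conj (fst w n) else 0)"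
    unfolding Z2_form_def by (intro arg_cong[where f = suminf]) (auto simp: unit_snd_def unit_seq_def)
  then show "Z2_form (unit_snd i) w = - conj (fst w i)"
    using sums_unique[OF sums_single[of i "\<lambda>n. - conj (fst w n)"]] by simp
qed

text \<open>The form is nondegenerate: pairing with unit vectors determines all coordinates of
  \<open>R v\<close>, so the definite description has a single candidate.\<close>

lemma Z2_adjoint_eq:
  assumes R: "R \<in> Z2_operators" and adj: "\<And>u v. u \<in> Z2 \<Longrightarrow> v \<in> Z2 \<Longrightarrow> Z2_form (T u) v = Z2_form u (R v)"
  shows "Z2_adjoint T = R"
  unfolding Z2_adjoint_def
proof (rule the_equality)
  show "R \<in> Z2_operators \<and> (\<forall>u\<in>Z2. \<forall>v\<in>Z2. Z2_form (T u) v = Z2_form u (R v))"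
    using R adj by blast
  fix R' assume R': "R' \<in> Z2_operators \<and> (\<forall>u\<in>Z2. \<forall>v\<in>Z2. Z2_form (T u) v = Z2_form u (R' v))"
  have conj_inj: "a = b" if "conj a = conj b" for a b :: 'a
    using that norm_conj[of "a - b"] by (simp add: conj_diff)
  show "R' = R"
  proof
    fix v :: "'a seq_pair"
    show "R' v = R v"
    proof (cases "v \<in> Z2")
      case True
      have "Z2_form u (R' v) = Z2_form u (R v)" if "u \<in> Z2" for u
        using R' adj that True by metis
      from this[OF unit_fst_Z2(1)] this[OF unit_snd_Z2(1)]
      have "conj (snd (R' v) i) = conj (snd (R v) i)" "conj (fst (R' v) i) = conj (fst (R v) i)" for i
        by (simp_all add: Z2_form_unit_left)
      then show ?thesis using conj_inj by (simp add: prod_eq_iff fun_eq_iff)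
    next
      case False
      then show ?thesis using R R' by (simp add: Z2_operatorsD(2))
    qed
  qed
qed

text \<open>It makes the classes nonempty, so that near-minimisers can be picked for the infimum in
  \<open>quotient_norm\<close>.\<close>

lemma zero_strictly_singular: "(0 :: 'k::real_or_complex seq_pair \<Rightarrow> 'k seq_pair) \<in> Z2_strictly_singular"
proof -
  have "(0 :: 'k seq_pair \<Rightarrow> 'k seq_pair) \<in> Z2_operators"
    unfolding Z2_operators_def by (auto intro!: exI[of _ 0])
  moreover have False
    if M: "closed_subspace_Z2 M" "infinite_dimensional M" "0 < c" "\<forall>u\<in>M. c * Z2_qnorm u \<le> Z2_qnorm 0"
    for M :: "'k seq_pair set" and c
  proof -
    have "u = 0" if "u \<in> M" for u
    proof (rule Z2_qnorm_eq_0)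
      show u: "u \<in> Z2" using M(1) that by (auto simp: closed_subspace_Z2_def)
      show "Z2_qnorm u = 0"
        using M(3,4) that Z2_qnorm_nonneg[OF u] by (metis Z2_zero(2) antisym mult_le_0_iff not_le)
    qed
    then have "M \<subseteq> seq_pair.span {}" by auto
    then show False using M(2) unfolding infinite_dimensional_def by blast
  qed
  ultimately show ?thesis unfolding Z2_strictly_singular_def by auto
qed

text \<open>Homogeneity reduces the claim to \<open>N v = 1\<close>, where the supremum in
  \<open>operator_norm\<close> applies. Passing between \<open>N\<close> and \<open>Z2_qnorm\<close>
  costs a factor \<open>c\<close> at each end.\<close>

lemma bounded_by_operator_norm:
  fixes N :: "'k::real_or_complex seq_pair \<Rightarrow> real"
  assumes N: "Z2_equivalent_norm N" and T: "T \<in> Z2_operators"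
    and c: "0 < c" "\<And>u. u \<in> Z2 \<Longrightarrow> N u \<le> c * Z2_qnorm u" "\<And>u. u \<in> Z2 \<Longrightarrow> Z2_qnorm u \<le> c * N u"
    and K: "operator_norm N T \<le> K"
  shows "qnorm_bound T (c * K * c)"
  unfolding qnorm_bound_def
proof
  fix u :: "'k seq_pair" assume u: "u \<in> Z2"
  note Tin = Z2_operatorsD(1)[OF T]
  have Nsc: "N (seq_scale a v) = norm a * N v" if "v \<in> Z2" for a v
    using N that unfolding Z2_equivalent_norm_def by blast
  show "Z2_qnorm (T u) \<le> c * K * c * Z2_qnorm u"
  proof (cases "u = 0")
    case True
    then show ?thesis by (simp add: Z2_operator_zero[OF T])
  next
    case False
    obtain C where C: "qnorm_bound T C" using Z2_operatorsD(5)[OF T] by blast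
    have "0 < Z2_qnorm u"
      using Z2_qnorm_nonneg[OF u] Z2_qnorm_eq_0[OF u] False by linarith
    then have Nu: "0 < N u" using c(1) c(3)[OF u] by (smt (verit) mult_nonneg_nonpos)
    define v where "v = seq_scale (of_real (1 / N u)) u"
    have v: "v \<in> Z2" "N v = 1" using u Nu by (simp_all add: v_def Z2_scale Nsc norm_divide)
    \<comment> \<open>A supremum of reals is known to be an upper bound only for sets bounded
      above.\<close>
    have bdd: "bdd_above ((\<lambda>u. N (T u)) ` {u \<in> Z2. N u \<le> 1})"
    proof (rule bdd_aboveI2)
      fix w assume w: "w \<in> {u \<in> Z2. N u \<le> 1}"
      then have "N (T w) \<le> c * Z2_qnorm (T w)" using c(2) Tin by blast
      also have "\<dots> \<le> c * (C * Z2_qnorm w)"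
        using C w c(1) unfolding qnorm_bound_def by (intro mult_left_mono) auto
      also have "\<dots> \<le> c * (C * (c * 1))"
      proof (intro mult_left_mono)
        show "Z2_qnorm w \<le> c * 1"
          using w c(1) by (intro order.trans[OF c(3)[of w]] mult_left_mono) auto
      qed (use c(1) qnorm_bound_nonneg[OF T C] in auto)
      finally show "N (T w) \<le> c * (C * (c * 1))" .
    qed
    have "N (T v) \<le> operator_norm N T"
      unfolding operator_norm_def by (rule cSUP_upper[OF _ bdd]) (use v in simp)
    moreover have "N (T v) = N (T u) / N u"
      using Nu by (simp add: v_def Z2_operatorsD(4)[OF T u] Nsc[OF Tin[OF u]] norm_divide)
    ultimately have K0: "N (T u) / N u \<le> K"
      using K by linarith
    then have NT: "N (T u) \<le> K * N u" using Nu by (simp add: pos_divide_le_eq)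
    have "0 \<le> N (T u)"
      using c(1) c(3)[OF Tin[OF u]] Z2_qnorm_nonneg[OF Tin[OF u]] by (smt (verit) mult_pos_neg)
    then have K1: "0 \<le> K" using K0 Nu by (smt (verit) divide_nonneg_pos)
    have "Z2_qnorm (T u) \<le> c * N (T u)" by (rule c(3)[OF Tin[OF u]])
    also have "\<dots> \<le> c * (K * N u)" using NT c(1) by simp
    also have "\<dots> \<le> c * (K * (c * Z2_qnorm u))"
      using c(1) K1 c(2)[OF u] by (intro mult_left_mono) auto
    finally show ?thesis by (simp add: mult.assoc)
  qed
qed

section \<open>The norm identity against the growth of \<open>ln (sqrt (2 ^ m))\<close>\<close>

theorem theorem6p31:
  fixes N :: "'k::real_or_complex seq_pair \<Rightarrow> real"
    and smul :: "'k \<Rightarrow> 'b::{real_normed_algebra, banach} \<Rightarrow> 'b"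
    and star :: "'b \<Rightarrow> 'b"
  assumes "Z2_equivalent_norm N"
    and "b_star_algebra smul star"
  shows "\<not> (\<exists>\<phi>. quotient_star_isomorphism N smul star \<phi>)"
proof
  interpret b_star_algebra smul star by fact
  assume "\<exists>\<phi>. quotient_star_isomorphism N smul star \<phi>"
  then obtain \<phi> where iso: "quotient_star_isomorphism N smul star \<phi>" by blast
  define f where "f T = \<phi> (SS_class T)" for T
  have mult: "f (T \<circ> R) = f T * f R" if "T \<in> Z2_operators" "R \<in> Z2_operators" for T R
    using iso that unfolding quotient_star_isomorphism_def f_def by blast
  have adj: "f (Z2_adjoint T) = star (f T)" if "T \<in> Z2_operators" for T
    using iso that unfolding quotient_star_isomorphism_def f_def by blast
  obtain C where C: "\<And>A. A \<in> Z2_quotient \<Longrightarrow> quotient_norm N A \<le> C * norm (\<phi> A)"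
    using iso unfolding quotient_star_isomorphism_def by blast
  \<comment> \<open>The sort of the algebra provides no unit, so the image of the identity is shown
    to act as a left unit on images of operators.\<close>
  have unit: "f Z2_identity * f T = f T" if T: "T \<in> Z2_operators" for T
  proof -
    have "Z2_identity \<circ> T = T"
      using Z2_operatorsD(1,2)[OF T] by (auto simp: fun_eq_iff Z2_identity_def)
    then show ?thesis using mult[OF Z2_identity_operator T] by simp
  qed
  \<comment> \<open>\<open>f (walsh l)\<close> is self-adjoint and its square acts as a unit, so
    \<open>star a * a\<close> is the same for \<open>a = f (walsh l \<circ> T)\<close> and
    \<open>a = f T\<close>; the B*-identity turns this into equality of norms.\<close>
  have walsh_norm: "norm (f (walsh l \<circ> T)) = norm (f T)" if T: "T \<in> Z2_operators" for l T
  proof -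
    have "Z2_adjoint (walsh l) = (walsh l :: 'k seq_pair \<Rightarrow> 'k seq_pair)"
      by (rule Z2_adjoint_eq[OF walsh_operator walsh_symmetric])
    then have st: "star (f (walsh l)) = f (walsh l)" using adj[OF walsh_operator, of l] by simp
    have "star (f (walsh l \<circ> T)) * f (walsh l \<circ> T) = star (f T) * (f (walsh l) * f (walsh l) * f T)"
      by (simp only: mult[OF walsh_operator T] star_mult st mult.assoc)
    also have "f (walsh l) * f (walsh l) * f T = f T"
      using mult[OF walsh_operator walsh_operator, of l l] unit[OF T] by (simp add: walsh_walsh)
    finally have "(norm (f (walsh l \<circ> T)))\<^sup>2 = (norm (f T))\<^sup>2"
      by (metis b_star)
    then show ?thesis by simp
  qed
  \<comment> \<open>Every \<open>f (hadamard m)\<close> has the norm of the image of the identity,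
    so \<open>Q\<close> bounds the quotient norms uniformly in \<open>m\<close>.\<close>
  define Q where "Q = C * norm (f Z2_identity)"
  have "norm (f (hadamard m)) = norm (f Z2_identity)" for m
    by (induction m) (simp_all add: walsh_norm hadamard_operator del: o_apply)
  then have qn: "quotient_norm N (SS_class (hadamard m)) \<le> Q" for m
    using C[of "SS_class (hadamard m)"] imageI[OF hadamard_operator[of m], of SS_class]
    by (simp add: Q_def f_def Z2_quotient_def)
  obtain c where c: "0 < c" "\<And>u. u \<in> Z2 \<Longrightarrow> N u \<le> c * Z2_qnorm u" "\<And>u. u \<in> Z2 \<Longrightarrow> Z2_qnorm u \<le> c * N u"
    using assms(1) unfolding Z2_equivalent_norm_def by blast
  have "ln (sqrt (2 ^ m)) \<le> 2 * (c * (Q + 1) * c)" for m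
  proof -
    let ?H = "hadamard m :: 'k seq_pair \<Rightarrow> 'k seq_pair"
    \<comment> \<open>The infimum may not be attained; the slack 1 yields a representative.\<close>
    have "Inf (operator_norm N ` SS_class ?H) < Q + 1"
      using qn[of m] by (simp add: quotient_norm_def)
    then obtain S where S: "S \<in> Z2_strictly_singular" "operator_norm N (?H - S) < Q + 1"
      using cInf_lessD[of "operator_norm N ` SS_class ?H"] zero_strictly_singular unfolding SS_class_def by blast
    have "?H - S \<in> Z2_operators"
      using S(1) by (intro Z2_operators_diff hadamard_operator) (simp add: Z2_strictly_singular_def)
    then have "qnorm_bound (?H - S) (c * (Q + 1) * c)"
      by (rule bounded_by_operator_norm[OF assms(1) _ c less_imp_le[OF S(2)]])
    then show ?thesis by (rule hadamard_distance_strictly_singular[OF S(1)])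
  qed
  moreover have "ln (sqrt (2 ^ m)) = real m * (ln 2 / 2)" for m :: nat
    by (simp add: ln_sqrt ln_realpow)
  ultimately have "real m * (ln 2 / 2) \<le> 2 * (c * (Q + 1) * c)" for m by metis
  moreover have "0 < ln 2 / (2::real)" by simp
  ultimately show False
    using reals_Archimedean3[of "ln 2 / 2"] by (meson not_less)
qed

end
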